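(* Let $\mathbf{y}''=C(x)\mathbf{y}$ be an irreducible linear system of $m$ second-order ordinary differential equations which admits one of the following one-, two- or three-dimensional Lie algebras of nontrivial generators, where $A_1,A_2,A_3$ denote constant $m\times m$ matrices: 1. $\{X_2+X_{A_2}\}$; 2. $\{X_3+X_{A_3}\}$; 3. $\{X_1+X_3+X_{A_1}\}$; 4. $\{X_2+X_{A_2},\ X_3+X_{A_3}\}$; 5. $\{X_1+X_{A_1},\ X_2+X_{A_2},\ X_3+X_{A_3}\}$. Then the system is equivalent to a system $\mathbf{y}''=C(x)\mathbf{y}$ of one of the following forms. (a) For the one-dimensional Lie algebras (1, 2, 3): $$C(x)=e^{xA}C_0e^{-xA},$$ where $A$ and $C_0$ are constant $m\times m$ matrices with $C_0A-AC_0\neq 0$. The admitted generator is $X=X_3+(A\mathbf{y})\cdot\nabla$. (b) For the two-dimensional Lie algebras $X_2+X_{A_2},\ X_3+X_{A_3}$ (4): $$C(x)=e^{xA_3}C_0e^{-xA_3},$$ where the constant $m\times m$ matrices $C_0$, $A_2$, $A_3$ satisfy $$A_2A_3-A_3(A_2+2E)=0,$$ $$A_2C_0-C_0(A_2+4E)=0,\qquad \operatorname{tr}(C_0)=0,\qquad A_3C_0-C_0A_3\neq 0.$$ (c) For the three-dimensional Lie algebras $X_1+X_{A_1},\ X_2+X_{A_2},\ X_3+X_{A_3}$ (5): $$C(x)=e^{xA_3}C_0e^{-xA_3},$$ where the constant $m\times m$ matrices $C_0$, $A_1$, $A_2$, $A_3$ satisfy $$A_1A_2-A_2A_1=2A_1,\qquad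 A_1A_3-A_3A_1=A_2,\qquad A_2A_3-A_3A_2=2A_3,$$ $$A_2C_0-C_0(A_2+4E)=0,\qquad C_0A_1-A_1C_0=0,\qquad \operatorname{tr}(C_0)=0,\qquad A_3C_0-C_0A_3\neq 0.$$
   Context: Systems: $\mathbf{y}=(y_1,\dots,y_m)^t$ is a vector of $m$ real unknown functions of the real variable $x$, $C(x)$ is a (smooth) real $m\times m$ matrix function, and $E$ is the $m\times m$ identity matrix. All matrices are real. As usual in Lie group analysis, changes of variables and admitted (point) symmetries are understood locally. Generators: $\nabla=(\partial_{y_1},\dots,\partial_{y_m})^t$ and $\mathbf{b}\cdot\nabla=\sum_i b_i\partial_{y_i}$. Put $$X_1=x(x\partial_x+\mathbf{y}\cdot\nabla),\quad X_2=2x\partial_x+\mathbf{y}\cdot\nabla,\quad X_3=\partial_x,\quad X_A=(A\mathbf{y})\cdot\nabla$$ for a constant $m\times m$ matrix $A$. A system admits a generator if the generator is an infinitesimal Lie point symmetry of the system. Every system $\mathbf{y}''=C(x)\mathbf{y}$ admits the trivial generators $\mathbf{y}\cdot\nabla$ and $\mathbf{h}(x)\cdot\nabla$ with $\mathbf{h}''=C\mathbf{h}$; these are excluded from consideration, so "admitted Lie algebra" refers to nontrivial generators, i.e. the trivial ones are disregarded. For constants $k_1,k_2,k_3$ and a constant matrix $A$, the generator $k_1X_1+k_2X_2+k_3X_3+X_A$ is admitted by $\mathbf{y}''=C(x)\mathbf{y}$ if and only if $$(k_1x^2+2k_2x+k_3)C'+CA-AC+4(k_1x+k_2)C=0.$$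 Equivalence: two systems are equivalent if one is carried to the other by a composition of the equivalence transformations of the class $\mathbf{y}''=\mathbf{F}(x,\mathbf{y})$: (i) $\widetilde{\mathbf{y}}=P\mathbf{y}$ with $P$ a constant nonsingular $m\times m$ matrix; (ii) $\widetilde{y}_i=y_i+\varphi_i(x)$, $i=1,\dots,m$; (iii) $\widetilde{x}=\varphi(x)$, $\widetilde{y}_i=\psi(x)y_i$, $i=1,\dots,m$, where $\varphi''/\varphi'=2\psi'/\psi$. Irreducibility: a system $\mathbf{y}''=\mathbf{F}(x,\mathbf{y})$ is called reducible if it is equivalent to a system which has a proper subsystem of fewer dimension (i.e. a proper nonempty subset of the equations that involves only the corresponding unknowns), or if it is equivalent, with respect to a change of the dependent and independent variables, to a linear system $\mathbf{y}''=C\mathbf{y}$ with $C$ a constant matrix. It is irreducible if it is not reducible. *)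

theory Defs
  imports "HOL-Analysis.Analysis"
begin

section \<open>Smooth maps\<close>

primrec Ck_on :: "nat \<Rightarrow> 'a::real_normed_vector set \<Rightarrow> ('a \<Rightarrow> 'b::real_normed_vector) \<Rightarrow> bool" where
  "Ck_on 0 S f \<longleftrightarrow> continuous_on S f"
| "Ck_on (Suc k) S f \<longleftrightarrow> (\<forall>x\<in>S. f differentiable (at x)) \<and>
     (\<forall>v. Ck_on k S (\<lambda>x. frechet_derivative f (at x) v))"

text \<open>Used for open sets \<open>S\<close> only.\<close>

definition smooth_on :: "'a::real_normed_vector set \<Rightarrow> ('a \<Rightarrow> 'b::real_normed_vector) \<Rightarrow> bool" where
  "smooth_on S f \<longleftrightarrow> (\<forall>k. Ck_on k S f)"

definition open_interval :: "real set \<Rightarrow> bool" where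
  "open_interval I \<longleftrightarrow> open I \<and> is_interval I \<and> I \<noteq> {}"

section \<open>Matrix exponential\<close>

text \<open>The type of square matrices is not an instance of \<^class>\<open>real_normed_algebra_1\<close> (its
  \<open>*\<close> is the componentwise product), so \<^const>\<open>exp\<close> does not apply to it.\<close>

definition mpow :: "real^'m^'m \<Rightarrow> nat \<Rightarrow> real^'m^'m" where
  "mpow A n = (((**) A) ^^ n) (mat 1)"

definition mexp :: "real^'m^'m \<Rightarrow> real^'m^'m" where
  "mexp A = (\<Sum>n. (1 / fact n) *\<^sub>R mpow A n)"

definition exp_conj :: "real^'m^'m \<Rightarrow> real^'m^'m \<Rightarrow> real \<Rightarrow> real^'m^'m" where
  "exp_conj A C0 x = mexp (x *\<^sub>R A) ** C0 ** mexp (- (x *\<^sub>R A))"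

section \<open>Systems of second-order equations\<close>

text \<open>The pair \<open>(I, F)\<close> stands for the system \<open>y'' = F(x, y)\<close> with \<open>x\<close> in the open interval \<open>I\<close>
  and \<open>y\<close> in \<open>\<real>\<^sup>m\<close>; values of \<open>F\<close> for \<open>x\<close> outside \<open>I\<close> are irrelevant.\<close>

type_synonym 'm system = "real set \<times> (real \<Rightarrow> real^'m \<Rightarrow> real^'m)"

definition linear_rhs :: "(real \<Rightarrow> real^'m^'m) \<Rightarrow> real \<Rightarrow> real^'m \<Rightarrow> real^'m" where
  "linear_rhs C x y = C x *v y"

definition satisfies_at ::
  "(real \<Rightarrow> real^'m \<Rightarrow> real^'m) \<Rightarrow> (real \<Rightarrow> real^'m) \<Rightarrow> real \<Rightarrow> bool" where
  "satisfies_at F y x \<longleftrightarrow>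
     (\<exists>y'. (\<forall>\<^sub>F t in nhds x. (y has_vector_derivative y' t) (at t)) \<and>
           (y' has_vector_derivative F x (y x)) (at x))"

section \<open>Changes of variables and equivalence\<close>

text \<open>\<open>T(x, y)\<close> is the pair of new variables.  The change of variables \<open>T\<close> carries
  \<open>y'' = F(x, y)\<close> to \<open>z'' = G(s, z)\<close> if, for every smooth curve \<open>y(x)\<close> with graph in \<open>U\<close> whose
  image under \<open>T\<close> is again the graph of a function \<open>z(s)\<close>, the first equation holds at a point of
  the curve iff the second one holds at the corresponding point of the image.\<close>

definition carries :: "(real \<times> (real^'m)) set \<Rightarrow> (real \<times> (real^'m) \<Rightarrow> real \<times> (real^'m)) \<Rightarrow>
    (real \<Rightarrow> real^'m \<Rightarrow> real^'m) \<Rightarrow> (real \<Rightarrow> real^'m \<Rightarrow> real^'m) \<Rightarrow> bool" where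
  "carries U T F G \<longleftrightarrow>
     (\<forall>N y z. open_interval N \<and> smooth_on N y \<and>
        (\<forall>x\<in>N. (x, y x) \<in> U \<and> deriv (\<lambda>t. fst (T (t, y t))) x \<noteq> 0 \<and>
               z (fst (T (x, y x))) = snd (T (x, y x)))
      \<longrightarrow> (\<forall>x\<in>N. satisfies_at F y x \<longleftrightarrow> satisfies_at G z (fst (T (x, y x)))))"

text \<open>The equivalence transformations of the class \<open>y'' = F(x, y)\<close>.  The restriction of the range
  of \<open>x\<close> expresses that equivalence is understood locally.\<close>

inductive elementary_equiv :: "'m::finite system \<Rightarrow> 'm system \<Rightarrow> bool" where
  restriction:
    "open_interval J \<Longrightarrow> J \<subseteq> I \<Longrightarrow> elementary_equiv (I, F) (J, F)"
| linear_change: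
    "invertible P \<Longrightarrow> carries (I \<times> UNIV) (\<lambda>(x, y). (x, P *v y)) F G
     \<Longrightarrow> elementary_equiv (I, F) (I, G)"
| shift:
    "smooth_on I h \<Longrightarrow> carries (I \<times> UNIV) (\<lambda>(x, y). (x, y + h x)) F G
     \<Longrightarrow> elementary_equiv (I, F) (I, G)"
| rescaling:
    "smooth_on I \<phi> \<Longrightarrow> smooth_on I \<psi> \<Longrightarrow>
     (\<forall>x\<in>I. deriv \<phi> x \<noteq> 0 \<and> \<psi> x \<noteq> 0 \<and>
            deriv (deriv \<phi>) x / deriv \<phi> x = 2 * deriv \<psi> x / \<psi> x) \<Longrightarrow>
     carries (I \<times> UNIV) (\<lambda>(x, y). (\<phi> x, \<psi> x *\<^sub>R y)) F G
     \<Longrightarrow> elementary_equiv (I, F) (\<phi> ` I, G)"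

definition equivalent_to :: "'m::finite system \<Rightarrow> 'm system \<Rightarrow> bool" where
  "equivalent_to = elementary_equiv\<^sup>*\<^sup>*"

text \<open>A general local change of the dependent and independent variables; by the inverse function
  theorem such a \<open>T\<close> is a diffeomorphism of \<open>U\<close> onto an open set.\<close>

definition point_transformation ::
  "(real \<times> (real^'m)) set \<Rightarrow> (real \<times> (real^'m) \<Rightarrow> real \<times> (real^'m)) \<Rightarrow> bool" where
  "point_transformation U T \<longleftrightarrow> open U \<and> U \<noteq> {} \<and> smooth_on U T \<and> inj_on T U \<and>
     (\<forall>p\<in>U. inj (frechet_derivative T (at p)))"

section \<open>Irreducibility\<close>

definition has_proper_subsystem :: "'m::finite system \<Rightarrow> bool" where
  "has_proper_subsystem S \<longleftrightarrow>
     (case S of (I, F) \<Rightarrow> \<exists>K. K \<noteq> {} \<and> K \<noteq> UNIV \<and>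
        (\<forall>x\<in>I. \<forall>y z. (\<forall>j\<in>K. y $ j = z $ j) \<longrightarrow> (\<forall>i\<in>K. F x y $ i = F x z $ i)))"

definition constant_coefficient_reducible :: "'m::finite system \<Rightarrow> bool" where
  "constant_coefficient_reducible S \<longleftrightarrow>
     (case S of (I, F) \<Rightarrow> \<exists>U T K. point_transformation U T \<and> U \<subseteq> I \<times> UNIV \<and>
        carries U T F (linear_rhs (\<lambda>_. K)))"

definition reducible :: "'m::finite system \<Rightarrow> bool" where
  "reducible S \<longleftrightarrow>
     (\<exists>S'. equivalent_to S S' \<and> has_proper_subsystem S') \<or> constant_coefficient_reducible S"

definition irreducible_system :: "'m::finite system \<Rightarrow> bool" where
  "irreducible_system S \<longleftrightarrow> \<not> reducible S"

section \<open>Lie point symmetries\<close>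

text \<open>The generator \<open>\<xi>(x,y) \<partial>\<^sub>x + \<eta>(x,y) \<cdot> \<nabla>\<close> is the vector field \<open>V = (\<xi>, \<eta>)\<close>.  The derivatives
  below are meaningful for smooth \<open>V\<close>; all generators in use are polynomial.
  \<open>prolong1\<close> and \<open>prolong2\<close> are the coefficients at \<open>\<partial>\<^bsub>y'\<^esub>\<close> and \<open>\<partial>\<^bsub>y''\<^esub>\<close> of the prolonged vector
  field, \<open>D\<^sub>x\<eta> - (D\<^sub>x\<xi>) y'\<close> and \<open>D\<^sub>x\<eta>\<^sup>(\<^sup>1\<^sup>) - (D\<^sub>x\<xi>) y''\<close>, at \<open>y' = p\<close>, \<open>y'' = q\<close>; the total
  derivative \<open>D\<^sub>x\<close> is the directional derivative along \<open>(1, p)\<close>, respectively \<open>(1, p, q)\<close>.\<close>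

type_synonym 'm vfield = "real \<times> (real^'m) \<Rightarrow> real \<times> (real^'m)"

definition prolong1 :: "'m::finite vfield \<Rightarrow> real \<times> (real^'m) \<times> (real^'m) \<Rightarrow> real^'m" where
  "prolong1 V = (\<lambda>(x, y, p).
     frechet_derivative (\<lambda>w. snd (V w)) (at (x, y)) (1, p) -
     frechet_derivative (\<lambda>w. fst (V w)) (at (x, y)) (1, p) *\<^sub>R p)"

definition prolong2 ::
  "'m::finite vfield \<Rightarrow> real \<times> (real^'m) \<times> (real^'m) \<times> (real^'m) \<Rightarrow> real^'m" where
  "prolong2 V = (\<lambda>(x, y, p, q).
     frechet_derivative (prolong1 V) (at (x, y, p)) (1, p, q) -
     frechet_derivative (\<lambda>w. fst (V w)) (at (x, y)) (1, p) *\<^sub>R q)"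

definition admits :: "'m::finite system \<Rightarrow> 'm vfield \<Rightarrow> bool" where
  "admits S V \<longleftrightarrow>
     (case S of (I, F) \<Rightarrow> \<forall>x\<in>I. \<forall>y p. prolong2 V (x, y, p, F x y) =
        frechet_derivative (\<lambda>(x, y). F x y) (at (x, y)) (V (x, y)))"

text \<open>The trivial generators of a linear system \<open>(I, F)\<close>: linear combinations of \<open>y \<cdot> \<nabla>\<close> and
  \<open>h(x) \<cdot> \<nabla>\<close> with \<open>h\<close> a solution.\<close>

definition trivial_generator :: "'m::finite system \<Rightarrow> 'm vfield \<Rightarrow> bool" where
  "trivial_generator S V \<longleftrightarrow>
     (case S of (I, F) \<Rightarrow> \<exists>c h. (\<forall>x\<in>I. satisfies_at F h x) \<and>
        (\<forall>x\<in>I. \<forall>y. V (x, y) = (0, c *\<^sub>R y + h x)))"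

definition lie_bracket :: "'m::finite vfield \<Rightarrow> 'm vfield \<Rightarrow> 'm vfield" where
  "lie_bracket V W = (\<lambda>w. frechet_derivative W (at w) (V w) - frechet_derivative V (at w) (W w))"

definition lincomb :: "'m::finite vfield set \<Rightarrow> ('m vfield \<Rightarrow> real) \<Rightarrow> 'm vfield" where
  "lincomb B c = (\<lambda>w. \<Sum>V\<in>B. c V *\<^sub>R V w)"

text \<open>The finite set \<open>B\<close> is a basis of a Lie algebra of admitted nontrivial generators, where
  linear independence and closure under brackets are taken modulo the trivial generators.\<close>

definition admits_lie_algebra :: "'m::finite system \<Rightarrow> 'm vfield set \<Rightarrow> bool" where
  "admits_lie_algebra S B \<longleftrightarrow> finite B \<and>
     (\<forall>V\<in>B. admits S V) \<and>
     (\<forall>c. trivial_generator S (lincomb B c) \<longrightarrow> (\<forall>V\<in>B. c V = 0)) \<and>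
     (\<forall>V\<in>B. \<forall>W\<in>B. \<exists>c. trivial_generator S (\<lambda>w. lie_bracket V W w - lincomb B c w))"

definition X1 :: "'m::finite vfield" where
  "X1 = (\<lambda>(x, y). (x * x, x *\<^sub>R y))"

definition X2 :: "'m::finite vfield" where
  "X2 = (\<lambda>(x, y). (2 * x, y))"

definition X3 :: "'m::finite vfield" where
  "X3 = (\<lambda>(x, y). (1, 0))"

definition XA :: "real^'m^'m \<Rightarrow> 'm::finite vfield" where
  "XA A = (\<lambda>(x, y). (0, A *v y))"

definition vadd :: "'m::finite vfield \<Rightarrow> 'm vfield \<Rightarrow> 'm vfield" (infixl "\<oplus>\<^sub>v" 65) where
  "V \<oplus>\<^sub>v W = (\<lambda>w. V w + W w)"

end

theory Submission
  imports Defs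
begin

text \<open>Write the first component of the admitted generator as \<open>\<xi>(x) = k\<^sub>1 x\<^sup>2 + 2 k\<^sub>2 x + k\<^sub>3\<close>; the
  determining equation is \<open>\<xi> C' + C A - A C + 2 \<xi>' C = 0\<close>.  Near a point with \<open>\<xi> \<noteq> 0\<close> the change
  \<open>s = \<integral> dx/\<xi>(x)\<close>, \<open>z = y / sqrt \<bar>\<xi>(x)\<bar>\<close> turns \<open>C\<close> into \<open>D = \<xi>\<^sup>2 C + (k\<^sub>2\<^sup>2 - k\<^sub>1 k\<^sub>3) E\<close> and the
  equation into \<open>dD/ds = A D - D A\<close>, that is \<open>D(s) = exp(s A) C\<^sub>0 exp(-s A)\<close>.  If \<open>C\<^sub>0\<close> commuted
  with \<open>A\<close>, then \<open>D\<close> would be constant and the system reducible.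

  For two and three generators \<open>X\<^sub>3\<close> already gives this form.  Closure under brackets modulo
  trivial generators yields the commutation relations of the \<open>A\<^sub>i\<close> up to multiples of \<open>E\<close>, which
  are absorbed by passing to \<open>B\<^sub>i = A\<^sub>i - c\<^sub>i E\<close>.  Then conjugation by \<open>exp(x B\<^sub>3)\<close> maps \<open>B\<^sub>2 + 2x B\<^sub>3\<close> to
  \<open>B\<^sub>2\<close> and \<open>B\<^sub>1 + x B\<^sub>2 + x\<^sup>2 B\<^sub>3\<close> to \<open>B\<^sub>1\<close>, so that the determining equations for \<open>X\<^sub>2\<close> and \<open>X\<^sub>1\<close>
  become conditions on \<open>C\<^sub>0\<close> alone.\<close>

section \<open>Smooth maps\<close>

text \<open>Agreement on an open set is agreement near each of its points, so the derivatives
  coincide there too and the induction passes to them.\<close>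

lemma Ck_on_cong:
  assumes "open S" and "Ck_on k S f" and "\<And>x. x \<in> S \<Longrightarrow> f x = g x"
  shows "Ck_on k S g"
  using assms(2,3)
proof (induction k arbitrary: f g)
  case 0
  then show ?case
    by (simp cong: continuous_on_cong)
next
  case (Suc k)
  have d: "g differentiable (at x)" if "x \<in> S" for x
  proof -
    have "f differentiable (at x)" using Suc.prems that by simp
    then show ?thesis
      using Suc.prems(2) \<open>open S\<close> that
      by (metis differentiable_def has_derivative_transform_within_open)
  qed
  have eq: "frechet_derivative f (at x) = frechet_derivative g (at x)" if "x \<in> S" for x
    using Suc.prems that \<open>open S\<close> by (intro frechet_derivative_transform_within_open[of f x S g]) auto
  have "Ck_on k S (\<lambda>x. frechet_derivative g (at x) v)" for v
  proof (rule Suc.IH)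
    show "Ck_on k S (\<lambda>x. frechet_derivative f (at x) v)" using Suc.prems(1) by simp
    show "frechet_derivative f (at x) v = frechet_derivative g (at x) v" if "x \<in> S" for x
      using eq[OF that] by simp
  qed
  then show ?case using d by simp
qed

text \<open>Lets an explicit derivative \<open>f'\<close> stand in for the choice operator
  \<open>frechet_derivative\<close> in smoothness proofs.\<close>

lemma Ck_on_SucI:
  assumes "open S" and "\<And>x. x \<in> S \<Longrightarrow> (f has_derivative f' x) (at x)"
    and "\<And>v. Ck_on k S (\<lambda>x. f' x v)"
  shows "Ck_on (Suc k) S f"
proof -
  have "Ck_on k S (\<lambda>x. frechet_derivative f (at x) v)" for v
    by (rule Ck_on_cong[OF assms(1) assms(3)[of v]]) (use assms(2) in \<open>metis frechet_derivative_at\<close>)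
  then show ?thesis using assms(2) by (auto simp: differentiable_def)
qed

lemma Ck_on_SucD:
  assumes "Ck_on (Suc k) S f" and "x \<in> S"
  shows "(f has_derivative frechet_derivative f (at x)) (at x)"
  using assms by (simp add: frechet_derivative_works)

lemma Ck_on_Suc_imp: "Ck_on (Suc k) S f \<Longrightarrow> Ck_on k S f"
proof (induction k arbitrary: f)
  case 0
  then show ?case
    by (auto intro!: continuous_at_imp_continuous_on differentiable_imp_continuous_within)
next
  case (Suc k)
  then show ?case by (metis Ck_on.simps(2))
qed

lemma Ck_on_const: "open S \<Longrightarrow> Ck_on k S (\<lambda>x. c)"
proof (induction k arbitrary: c)
  case (Suc k)
  then show ?case by (intro Ck_on_SucI[where f' = "\<lambda>x v. 0"]) auto
qed simp

lemma Ck_on_bounded_linear: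
  assumes "open S" and "bounded_linear f"
  shows "Ck_on k S f"
proof (cases k)
  case 0
  then show ?thesis using assms(2) by (simp add: linear_continuous_on)
next
  case (Suc l)
  then show ?thesis
    using assms by (auto intro!: Ck_on_SucI[where f' = "\<lambda>x. f"] Ck_on_const
      bounded_linear_imp_has_derivative simp del: Ck_on.simps)
qed

lemma Ck_on_add:
  assumes "open S"
  shows "Ck_on k S f \<Longrightarrow> Ck_on k S g \<Longrightarrow> Ck_on k S (\<lambda>x. f x + g x)"
proof (induction k arbitrary: f g)
  case 0
  then show ?case by (simp add: continuous_on_add)
next
  case (Suc k)
  show ?case
  proof (rule Ck_on_SucI[OF assms])
    show "((\<lambda>x. f x + g x) has_derivative
        (\<lambda>v. frechet_derivative f (at x) v + frechet_derivative g (at x) v)) (at x)" if "x \<in> S" for x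
      using Ck_on_SucD[OF Suc.prems(1) that] Ck_on_SucD[OF Suc.prems(2) that]
      by (rule has_derivative_add)
    show "Ck_on k S (\<lambda>x. frechet_derivative f (at x) v + frechet_derivative g (at x) v)" for v
      using Suc.prems by (intro Suc.IH) auto
  qed
qed

lemma Ck_on_scaleR:
  fixes f :: "'a::real_normed_vector \<Rightarrow> real"
  assumes "open S"
  shows "Ck_on k S f \<Longrightarrow> Ck_on k S g \<Longrightarrow> Ck_on k S (\<lambda>x. f x *\<^sub>R g x)"
proof (induction k arbitrary: f g)
  case 0
  then show ?case by (simp add: continuous_on_scaleR)
next
  case (Suc k)
  show ?case
  proof (rule Ck_on_SucI[OF assms])
    show "((\<lambda>x. f x *\<^sub>R g x) has_derivative
        (\<lambda>v. f x *\<^sub>R frechet_derivative g (at x) v + frechet_derivative f (at x) v *\<^sub>R g x)) (at x)"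
      if "x \<in> S" for x
      using Ck_on_SucD[OF Suc.prems(1) that] Ck_on_SucD[OF Suc.prems(2) that]
      by (rule has_derivative_scaleR)
    show "Ck_on k S (\<lambda>x. f x *\<^sub>R frechet_derivative g (at x) v
        + frechet_derivative f (at x) v *\<^sub>R g x)" for v
      using Suc.prems Ck_on_Suc_imp[OF Suc.prems(1)] Ck_on_Suc_imp[OF Suc.prems(2)]
      by (intro Ck_on_add[OF assms] Suc.IH) auto
  qed
qed

lemma Ck_on_mult:
  fixes f g :: "'a::real_normed_vector \<Rightarrow> real"
  assumes "open S" and "Ck_on k S f" and "Ck_on k S g"
  shows "Ck_on k S (\<lambda>x. f x * g x)"
  using Ck_on_scaleR[OF assms] by simp

text \<open>The derivative in a fixed direction \<open>v\<close> is again a function of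
  \<open>fst p\<close> alone, which closes the induction.\<close>

lemma Ck_on_compose_fst:
  fixes f :: "'a::real_normed_vector \<Rightarrow> 'b::real_normed_vector"
  assumes "open S"
  shows "Ck_on k S f \<Longrightarrow> Ck_on k (S \<times> (UNIV :: 'c::real_normed_vector set)) (\<lambda>p. f (fst p))"
proof (induction k arbitrary: f)
  case 0
  have "continuous_on (S \<times> (UNIV :: 'c set)) fst" by (intro continuous_intros)
  moreover have "continuous_on S f" using 0 by simp
  ultimately have "continuous_on (S \<times> (UNIV :: 'c set)) (\<lambda>p. f (fst p))"
    using continuous_on_compose2[of S f "S \<times> (UNIV :: 'c set)" fst] by auto
  then show ?case by simp
next
  case (Suc k)
  show ?case
  proof (rule Ck_on_SucI)
    show "open (S \<times> (UNIV :: 'c set))" using assms by (simp add: open_Times)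
    show "((\<lambda>p. f (fst p)) has_derivative (\<lambda>v. frechet_derivative f (at (fst p)) (fst v))) (at p)"
      if "p \<in> S \<times> (UNIV :: 'c set)" for p
    proof -
      have "(f has_derivative frechet_derivative f (at (fst p))) (at (fst p))"
        using that by (intro Ck_on_SucD[OF Suc.prems]) auto
      from has_derivative_compose[OF has_derivative_fst[OF has_derivative_ident] this]
      show ?thesis by simp
    qed
    show "Ck_on k (S \<times> (UNIV :: 'c set)) (\<lambda>p. frechet_derivative f (at (fst p)) (fst v))" for v :: "'a \<times> 'c"
      using Suc by (intro Suc.IH) simp
  qed
qed

lemma smooth_on_has_vector_derivative:
  fixes f :: "real \<Rightarrow> 'b::real_normed_vector"
  assumes "smooth_on S f" and "x \<in> S"
  shows "(f has_vector_derivative frechet_derivative f (at x) 1) (at x)"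
proof -
  have "Ck_on (Suc 0) S f" using assms(1) unfolding smooth_on_def by blast
  from Ck_on_SucD[OF this assms(2)] have *: "(f has_derivative frechet_derivative f (at x)) (at x)" .
  then interpret bounded_linear "frechet_derivative f (at x)" by (rule has_derivative_bounded_linear)
  have "frechet_derivative f (at x) = (\<lambda>h. h *\<^sub>R frechet_derivative f (at x) 1)"
  proof
    show "frechet_derivative f (at x) h = h *\<^sub>R frechet_derivative f (at x) 1" for h
      using scaleR[of h 1] by simp
  qed
  with * show ?thesis unfolding has_vector_derivative_def by simp
qed

lemma smooth_on_derivative:
  fixes f :: "real \<Rightarrow> 'b::real_normed_vector"
  assumes "smooth_on S f"
  shows "smooth_on S (\<lambda>x. frechet_derivative f (at x) 1)"
  using assms unfolding smooth_on_def by (metis Ck_on.simps(2))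

section \<open>The matrix exponential\<close>

lemma bounded_bilinear_matrix_matrix_mult:
  "bounded_bilinear ((**) :: real^'m^'m \<Rightarrow> real^'m^'m \<Rightarrow> real^'m^'m)"
proof -
  have "bilinear ((**) :: real^'m^'m \<Rightarrow> real^'m^'m \<Rightarrow> real^'m^'m)"
    unfolding bilinear_def linear_iff
    by (simp add: vec_eq_iff matrix_matrix_mult_def sum.distrib algebra_simps sum_distrib_left)
  then show ?thesis by (simp add: bilinear_conv_bounded_bilinear)
qed

interpretation matmul: bounded_bilinear "(**) :: real^'m^'m \<Rightarrow> real^'m^'m \<Rightarrow> real^'m^'m"
  by (rule bounded_bilinear_matrix_matrix_mult)

lemmas matmul_simps = matmul.add_left matmul.add_right matmul.diff_left matmul.diff_right
  matmul.minus_left matmul.minus_right matmul.scaleR_left matmul.scaleR_right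
  matmul.zero_left matmul.zero_right matrix_mul_assoc

lemma mpow_Suc: "mpow A (Suc n) = A ** mpow A n"
  by (simp add: mpow_def)

lemma mpow_0: "mpow A 0 = mat 1"
  by (simp add: mpow_def)

lemma mpow_commute: "mpow A n ** A = A ** mpow A n"
  for A :: "real^'m^'m"
  by (induction n) (simp_all add: mpow_0 mpow_Suc flip: matrix_mul_assoc)

lemma mpow_scaleR: "mpow (x *\<^sub>R A) n = x ^ n *\<^sub>R mpow A n"
  for A :: "real^'m^'m"
  by (induction n) (simp_all add: mpow_0 mpow_Suc matmul_simps)

text \<open>Boundedness of the bilinear product bounds the effect of each further factor
  \<open>A\<close>, so powers grow at most geometrically and a scalar exponential series dominates
  that of \<open>mexp\<close>.\<close>

lemma norm_mpow_le:
  fixes A :: "real^'m^'m"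
  obtains c K where "\<And>n. norm (mpow A n) \<le> c * K ^ n"
proof -
  have "\<exists>K\<ge>0. \<forall>(X :: real^'m^'m) (Y :: real^'m^'m). norm (X ** Y) \<le> norm X * norm Y * K"
    by (rule matmul.nonneg_bounded)
  then obtain K where K: "0 \<le> K" "\<And>(X :: real^'m^'m) (Y :: real^'m^'m). norm (X ** Y) \<le> norm X * norm Y * K"
    by blast
  have "norm (mpow A n) \<le> norm (mat 1 :: real^'m^'m) * (norm A * K) ^ n" for n
  proof (induction n)
    case (Suc n)
    have "norm (mpow A (Suc n)) \<le> norm A * norm (mpow A n) * K"
      unfolding mpow_Suc by (rule K)
    also have "\<dots> \<le> norm A * (norm (mat 1 :: real^'m^'m) * (norm A * K) ^ n) * K"
      using Suc K(1) by (intro mult_right_mono mult_left_mono) auto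
    finally show ?case by (simp add: algebra_simps)
  qed (simp add: mpow_0)
  then show ?thesis by (rule that)
qed

lemma summable_mexp: "summable (\<lambda>n. (1 / fact n) *\<^sub>R mpow A n)"
  for A :: "real^'m^'m"
proof -
  obtain c K where cK: "\<And>n. norm (mpow A n) \<le> c * K ^ n"
    using norm_mpow_le[of A] by blast
  have "summable (\<lambda>n. c * (inverse (fact n) * K ^ n))"
    by (intro summable_mult summable_exp)
  moreover have "norm ((1 / fact n) *\<^sub>R mpow A n) \<le> c * (inverse (fact n) * K ^ n)" for n
    using cK[of n] by (simp add: field_simps)
  ultimately show ?thesis by (rule summable_comparison_test'[where N = 0])
qed

lemma mexp_zero: "mexp 0 = (mat 1 :: real^'m^'m)"
proof -
  have "(\<Sum>n. (1 / fact n) *\<^sub>R mpow 0 n) = (\<Sum>n\<in>{0}. (1 / fact n) *\<^sub>R mpow (0 :: real^'m^'m) n)"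
  proof (rule suminf_finite)
    show "(1 / fact n) *\<^sub>R mpow (0 :: real^'m^'m) n = 0" if "n \<notin> {0}" for n
      using that by (cases n) (simp_all add: mpow_Suc matmul_simps)
  qed simp
  then show ?thesis unfolding mexp_def by (simp add: mpow_0)
qed

lemma mexp_commute: "mexp (x *\<^sub>R A) ** A = A ** mexp (x *\<^sub>R A)"
  for A :: "real^'m^'m"
proof -
  have "mexp (x *\<^sub>R A) ** A = (\<Sum>n. ((1 / fact n) *\<^sub>R mpow (x *\<^sub>R A) n) ** A)"
    unfolding mexp_def by (rule bounded_linear.suminf[OF matmul.bounded_linear_left summable_mexp])
  also have "\<dots> = (\<Sum>n. A ** ((1 / fact n) *\<^sub>R mpow (x *\<^sub>R A) n))"
    by (simp add: matmul_simps mpow_scaleR mpow_commute)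
  also have "\<dots> = A ** mexp (x *\<^sub>R A)"
    unfolding mexp_def by (rule bounded_linear.suminf[OF matmul.bounded_linear_right summable_mexp, symmetric])
  finally show ?thesis .
qed

text \<open>Each component of \<open>mexp (x *\<^sub>R A)\<close> is an everywhere convergent real
  power series in \<open>x\<close>, so termwise differentiation applies component by
  component.\<close>

lemma has_vector_derivative_mexp:
  fixes A :: "real^'m^'m"
  shows "((\<lambda>x. mexp (x *\<^sub>R A)) has_vector_derivative (A ** mexp (x *\<^sub>R A))) (at x)"
proof -
  have comp: "((\<lambda>x. mexp (x *\<^sub>R A) \<bullet> b) has_real_derivative ((A ** mexp (x *\<^sub>R A)) \<bullet> b)) (at x)" for b
  proof -
    define c where "c = (\<lambda>n. (mpow A n \<bullet> b) / fact n)"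
    have series: "(\<lambda>n. c n * y ^ n) sums (mexp (y *\<^sub>R A) \<bullet> b)" for y
    proof -
      have "(\<lambda>n. ((1 / fact n) *\<^sub>R mpow (y *\<^sub>R A) n) \<bullet> b) sums (mexp (y *\<^sub>R A) \<bullet> b)"
        unfolding mexp_def
        by (rule bounded_linear.sums[OF bounded_linear_inner_left summable_sums[OF summable_mexp]])
      then show ?thesis by (simp add: c_def mpow_scaleR field_simps)
    qed
    have "(\<lambda>n. (A ** ((1 / fact n) *\<^sub>R mpow (x *\<^sub>R A) n)) \<bullet> b) sums ((A ** mexp (x *\<^sub>R A)) \<bullet> b)"
      unfolding mexp_def
      by (rule bounded_linear.sums[OF bounded_linear_inner_left
            bounded_linear.sums[OF matmul.bounded_linear_right summable_sums[OF summable_mexp]]])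
    \<comment> \<open>\<open>diffs\<close> shifts the index by one and cancels a factor of the
      factorial; the extra factor in \<open>mpow A (Suc n)\<close> is the \<open>A\<close> of the
      derivative.\<close>
    moreover have "(A ** ((1 / fact n) *\<^sub>R mpow (x *\<^sub>R A) n)) \<bullet> b = diffs c n * x ^ n" for n
    proof -
      have "diffs c n = (mpow A (Suc n) \<bullet> b) / fact n"
        unfolding diffs_def c_def by (simp add: field_simps del: of_nat_Suc)
      then show ?thesis by (simp add: mpow_scaleR matmul_simps mpow_Suc)
    qed
    ultimately have "(\<Sum>n. diffs c n * x ^ n) = (A ** mexp (x *\<^sub>R A)) \<bullet> b"
      by (simp add: sums_iff)
    moreover have "((\<lambda>x. \<Sum>n. c n * x^n) has_field_derivative (\<Sum>n. diffs c n * x^n)) (at x)"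
      by (rule termdiffs_strong_converges_everywhere) (use series in \<open>auto simp: sums_iff\<close>)
    moreover have "(\<lambda>x. \<Sum>n. c n * x^n) = (\<lambda>x. mexp (x *\<^sub>R A) \<bullet> b)"
      using series by (auto simp: sums_iff)
    ultimately show ?thesis by simp
  qed
  show ?thesis
    unfolding has_vector_derivative_def
    by (subst has_derivative_componentwise_within)
      (use comp in \<open>simp add: has_real_derivative_iff_has_vector_derivative has_vector_derivative_def\<close>)
qed

text \<open>The device behind the matrix identities below: a vanishing derivative together with one
  known value.\<close>

lemma has_vector_derivative_zero_eq:
  fixes f :: "real \<Rightarrow> 'b::real_normed_vector"
  assumes "open_interval I" and "\<And>x. x \<in> I \<Longrightarrow> (f has_vector_derivative 0) (at x)"
    and "x \<in> I" and "y \<in> I"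
  shows "f x = f y"
  using assms by (intro has_derivative_zero_unique[of I])
    (auto simp: open_interval_def is_interval_convex has_vector_derivative_def intro: has_derivative_at_withinI)

lemma open_interval_UNIV: "open_interval UNIV"
  by (simp add: open_interval_def)

lemma has_vector_derivative_mexp_uminus:
  fixes A :: "real^'m^'m"
  shows "((\<lambda>x. mexp (- (x *\<^sub>R A))) has_vector_derivative (- (A ** mexp (- (x *\<^sub>R A))))) (at x)"
  using has_vector_derivative_mexp[of "- A" x] by (simp add: matmul_simps)

text \<open>The product of the two exponentials has derivative zero, because both commute with the
  matrix, and equals \<open>mat 1\<close> at \<open>0\<close>.\<close>

lemma mexp_inverse:
  fixes A :: "real^'m^'m"
  shows "mexp (x *\<^sub>R A) ** mexp (- (x *\<^sub>R A)) = mat 1"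
    and "mexp (- (x *\<^sub>R A)) ** mexp (x *\<^sub>R A) = mat 1"
proof -
  have *: "mexp (x *\<^sub>R B) ** mexp (- (x *\<^sub>R B)) = mat 1" for B :: "real^'m^'m" and x
  proof -
    have "((\<lambda>x. mexp (x *\<^sub>R B) ** mexp (- (x *\<^sub>R B))) has_vector_derivative 0) (at x)" for x
      by (rule has_vector_derivative_eq_rhs[OF matmul.has_vector_derivative[OF
            has_vector_derivative_mexp has_vector_derivative_mexp_uminus]])
        (simp add: matmul_simps mexp_commute)
    from has_vector_derivative_zero_eq[OF open_interval_UNIV this, of x 0] show ?thesis
      by (simp add: mexp_zero)
  qed
  from *[of x A] show "mexp (x *\<^sub>R A) ** mexp (- (x *\<^sub>R A)) = mat 1" .
  from *[of x "- A"] show "mexp (- (x *\<^sub>R A)) ** mexp (x *\<^sub>R A) = mat 1" by simp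
qed

section \<open>Conjugation by the one-parameter group of a matrix\<close>

lemma exp_conj_zero: "exp_conj A C0 0 = C0"
  by (simp add: exp_conj_def mexp_zero)

text \<open>Product rule for a moving matrix \<open>M\<close>: since \<open>A\<close> commutes with
  its exponential, the derivatives of the outer factors form a commutator inside the
  conjugation.\<close>

lemma has_vector_derivative_exp_conj:
  fixes A :: "real^'m^'m"
  assumes "(M has_vector_derivative M') (at x)"
  shows "((\<lambda>x. exp_conj A (M x) x) has_vector_derivative
      exp_conj A (A ** M x - M x ** A + M') x) (at x)"
  unfolding exp_conj_def
  by (rule has_vector_derivative_eq_rhs[OF matmul.has_vector_derivative[OF
          matmul.has_vector_derivative[OF has_vector_derivative_mexp assms]
          has_vector_derivative_mexp_uminus]])
    (simp add: matmul_simps mexp_commute)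

lemma exp_conj_add: "exp_conj A (M + N) x = exp_conj A M x + exp_conj A N x"
  and exp_conj_diff: "exp_conj A (M - N) x = exp_conj A M x - exp_conj A N x"
  and exp_conj_scaleR: "exp_conj A (c *\<^sub>R M) x = c *\<^sub>R exp_conj A M x"
  for A M N :: "real^'m^'m"
  by (simp_all add: exp_conj_def matmul_simps mexp_inverse)

lemma exp_conj_mult: "exp_conj A (M ** N) x = exp_conj A M x ** exp_conj A N x"
  for A M N :: "real^'m^'m"
proof -
  have "exp_conj A M x ** exp_conj A N x =
      mexp (x *\<^sub>R A) ** M ** (mexp (- (x *\<^sub>R A)) ** mexp (x *\<^sub>R A)) ** N ** mexp (- (x *\<^sub>R A))"
    by (simp add: exp_conj_def matrix_mul_assoc)
  then show ?thesis by (simp add: exp_conj_def mexp_inverse matrix_mul_assoc)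
qed

lemma exp_conj_self: "exp_conj A A x = A"
  for A :: "real^'m^'m"
  unfolding exp_conj_def by (simp add: mexp_commute flip: matrix_mul_assoc) (simp add: mexp_inverse)

lemma exp_conj_inverse: "exp_conj A (exp_conj (- A) M x) x = M"
  for A M :: "real^'m^'m"
proof -
  have "exp_conj A (exp_conj (- A) M x) x =
     (mexp (x *\<^sub>R A) ** mexp (- (x *\<^sub>R A))) ** M ** (mexp (x *\<^sub>R A) ** mexp (- (x *\<^sub>R A)))"
    by (simp add: exp_conj_def matrix_mul_assoc)
  then show ?thesis by (simp add: mexp_inverse)
qed

lemma exp_conj_cancel: "exp_conj A M x = exp_conj A N x \<Longrightarrow> M = N"
  for A M N :: "real^'m^'m"
  using exp_conj_inverse[of "- A" M x] exp_conj_inverse[of "- A" N x] by simp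

text \<open>Conjugating \<open>C\<close> backwards, with \<open>- A\<close>, cancels the commutator
  in the equation; the result is constant on the interval, and this constant is
  \<open>C0\<close>.\<close>

lemma exp_conj_ode_unique:
  fixes A :: "real^'m^'m"
  assumes "open_interval I"
    and "\<And>x. x \<in> I \<Longrightarrow> (C has_vector_derivative (A ** C x - C x ** A)) (at x)"
  obtains C0 where "\<And>x. x \<in> I \<Longrightarrow> C x = exp_conj A C0 x"
proof -
  obtain a where "a \<in> I" using assms(1) by (auto simp: open_interval_def)
  have "exp_conj (- A) (C x) x = exp_conj (- A) (C a) a" if "x \<in> I" for x
    by (rule has_vector_derivative_zero_eq[OF assms(1) _ that \<open>a \<in> I\<close>])
      (rule has_vector_derivative_eq_rhs[OF has_vector_derivative_exp_conj[OF assms(2)]],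
       simp_all add: exp_conj_def matmul_simps)
  then have "C x = exp_conj A (exp_conj (- A) (C a) a) x" if "x \<in> I" for x
    using that exp_conj_inverse by metis
  then show ?thesis by (rule that)
qed

text \<open>The commutator of \<open>B3\<close> with the affine matrix is
  \<open>- 2 *\<^sub>R B3\<close>, opposite to the derivative of that matrix, so the conjugate keeps
  its value at \<open>0\<close>.\<close>

lemma exp_conj_affine_commutator:
  fixes B2 B3 :: "real^'m^'m"
  assumes "B2 ** B3 - B3 ** B2 = 2 *\<^sub>R B3"
  shows "exp_conj B3 (B2 + (2 * x) *\<^sub>R B3) x = B2"
proof -
  have "((\<lambda>x. exp_conj B3 (B2 + (2 * x) *\<^sub>R B3) x) has_vector_derivative 0) (at x)" for x
  proof (rule has_vector_derivative_eq_rhs[OF has_vector_derivative_exp_conj])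
    show "((\<lambda>x. B2 + (2 * x) *\<^sub>R B3) has_vector_derivative 2 *\<^sub>R B3) (at x)"
      by (auto intro!: derivative_eq_intros)
    show "exp_conj B3 (B3 ** (B2 + (2 * x) *\<^sub>R B3) - (B2 + (2 * x) *\<^sub>R B3) ** B3 + 2 *\<^sub>R B3) x = 0"
      using assms by (simp add: matmul_simps algebra_simps) (simp add: exp_conj_def matmul_simps)
  qed
  from has_vector_derivative_zero_eq[OF open_interval_UNIV this, of x 0] show ?thesis
    by (simp add: exp_conj_zero)
qed

text \<open>As in the affine case: the commutator of \<open>B3\<close> with the quadratic matrix is
  \<open>- B2 - (2 * x) *\<^sub>R B3\<close>, opposite to its derivative.\<close>

lemma exp_conj_quadratic_commutator:
  fixes B1 B2 B3 :: "real^'m^'m"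
  assumes "B2 ** B3 - B3 ** B2 = 2 *\<^sub>R B3" and "B1 ** B3 - B3 ** B1 = B2"
  shows "exp_conj B3 (B1 + x *\<^sub>R B2 + (x * x) *\<^sub>R B3) x = B1"
proof -
  have "((\<lambda>x. exp_conj B3 (B1 + x *\<^sub>R B2 + (x * x) *\<^sub>R B3) x) has_vector_derivative 0) (at x)" for x
  proof (rule has_vector_derivative_eq_rhs[OF has_vector_derivative_exp_conj])
    show "((\<lambda>x. B1 + x *\<^sub>R B2 + (x * x) *\<^sub>R B3) has_vector_derivative B2 + (2 * x) *\<^sub>R B3) (at x)"
      by (auto intro!: derivative_eq_intros)
    have "B3 ** (B1 + x *\<^sub>R B2 + (x * x) *\<^sub>R B3) - (B1 + x *\<^sub>R B2 + (x * x) *\<^sub>R B3) ** B3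
        = - (B1 ** B3 - B3 ** B1) - x *\<^sub>R (B2 ** B3 - B3 ** B2)"
      by (simp add: matmul_simps algebra_simps)
    then show "exp_conj B3 (B3 ** (B1 + x *\<^sub>R B2 + (x * x) *\<^sub>R B3)
        - (B1 + x *\<^sub>R B2 + (x * x) *\<^sub>R B3) ** B3 + (B2 + (2 * x) *\<^sub>R B3)) x = 0"
      unfolding assms by (simp add: exp_conj_def matmul_simps)
  qed
  from has_vector_derivative_zero_eq[OF open_interval_UNIV this, of x 0] show ?thesis
    by (simp add: exp_conj_zero)
qed

section \<open>Changes of variables\<close>

text \<open>Derivatives are unique, so every candidate for the first derivative agrees with
  \<open>z'\<close> near \<open>s\<close>; the existential in \<open>satisfies_at\<close> thus
  becomes an equation.\<close>

lemma satisfies_at_iff: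
  assumes "\<forall>\<^sub>F t in nhds s. (z has_vector_derivative z' t) (at t)"
    and "(z' has_vector_derivative z'') (at s)"
  shows "satisfies_at G z s \<longleftrightarrow> z'' = G s (z s)"
proof
  assume "satisfies_at G z s"
  then obtain u where u: "\<forall>\<^sub>F t in nhds s. (z has_vector_derivative u t) (at t)"
    "(u has_vector_derivative G s (z s)) (at s)"
    unfolding satisfies_at_def by blast
  have "\<forall>\<^sub>F t in nhds s. z' t = u t"
    using assms(1) u(1) by eventually_elim (rule vector_derivative_unique_at)
  then obtain S where S: "open S" "s \<in> S" "\<And>t. t \<in> S \<Longrightarrow> z' t = u t"
    by (auto simp: eventually_nhds)
  have "(u has_vector_derivative z'') (at s)"
    by (rule has_vector_derivative_transform_within_open[OF assms(2) S])
  then show "z'' = G s (z s)"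
    using u(2) by (rule vector_derivative_unique_at)
next
  assume "z'' = G s (z s)"
  then show "satisfies_at G z s"
    unfolding satisfies_at_def using assms by blast
qed

lemma satisfies_at_zero: "satisfies_at (linear_rhs C) (\<lambda>_. 0) x"
  by (rule satisfies_at_iff[where z' = "\<lambda>_. 0" and z'' = 0, THEN iffD2])
    (simp_all add: linear_rhs_def)

text \<open>For \<open>\<xi>(x) = k\<^sub>1 x\<^sup>2 + 2 k\<^sub>2 x + k\<^sub>3\<close> without zeros on \<open>J\<close> and of sign \<open>\<sigma>\<close>, the new variables are
  \<open>\<phi>(x) = \<integral> dx/\<xi>(x)\<close> and \<open>w(x) y\<close> with \<open>w = \<bar>\<xi>\<bar>\<close> to the power \<open>-1/2\<close>.  They straighten the generator
  with first component \<open>\<xi>\<close>.\<close>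

locale straightening =
  fixes J :: "real set" and k1 k2 k3 \<sigma> :: real and \<phi> w :: "real \<Rightarrow> real"
  assumes J: "open_interval J"
    and \<sigma>: "\<sigma> * \<sigma> = 1"
    and w: "x \<in> J \<Longrightarrow> \<sigma> * (k1 * (x * x) + 2 * k2 * x + k3) * (w x * w x) = 1"
    and dw: "x \<in> J \<Longrightarrow> (w has_real_derivative (- \<sigma> * (k1 * x + k2) * (w x * w x * w x))) (at x)"
    and d\<phi>: "x \<in> J \<Longrightarrow> (\<phi> has_real_derivative (\<sigma> * (w x * w x))) (at x)"
begin

abbreviation \<xi> where "\<xi> x \<equiv> k1 * (x * x) + 2 * k2 * x + k3"

lemma open_J: "open J"
  using J by (simp add: open_interval_def)

lemma w_nonzero: "x \<in> J \<Longrightarrow> w x \<noteq> 0"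
  using w[of x] by auto

lemma \<sigma>_nonzero: "\<sigma> \<noteq> 0"
  using \<sigma> by auto

text \<open>By Rolle, two equal values would force a zero of the derivative
  \<open>\<sigma> * (w x * w x)\<close>, which has none.\<close>

lemma inj_\<phi>: "inj_on \<phi> J"
proof -
  have False if "a \<in> J" "b \<in> J" "\<phi> a = \<phi> b" "a < b" for a b
  proof -
    have sub: "{a..b} \<subseteq> J"
      using that J by (meson atLeastAtMost_iff mem_is_interval_1_I open_interval_def subsetI)
    obtain z where z: "a < z" "z < b" "DERIV \<phi> z :> 0"
    proof -
      have "continuous_on {a..b} \<phi>"
        using sub d\<phi> by (meson DERIV_isCont continuous_at_imp_continuous_on subsetD)
      moreover have "\<phi> differentiable (at x)" if "a < x" "x < b" for x
      proof -
        have "x \<in> J" using sub that by auto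
        then show ?thesis using d\<phi> by (auto simp: real_differentiable_def)
      qed
      ultimately show ?thesis using Rolle[OF \<open>a < b\<close> \<open>\<phi> a = \<phi> b\<close>] that by blast
    qed
    then have "z \<in> J" using sub by auto
    then have "\<sigma> * (w z * w z) = 0"
      using z(3) d\<phi> DERIV_unique by blast
    then show False using w_nonzero[OF \<open>z \<in> J\<close>] \<sigma>_nonzero by simp
  qed
  then show ?thesis by (metis inj_onI linorder_neqE_linordered_idom)
qed

lemma continuous_\<phi>: "continuous_on J \<phi>"
  using d\<phi> by (meson DERIV_isCont continuous_at_imp_continuous_on)

text \<open>The derivative of \<open>\<phi>\<close> is invertible, so \<open>\<phi>\<close> is open.
  This turns statements about all points near \<open>x\<close> into statements about all points near
  \<open>\<phi> x\<close>.\<close>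

lemma open_image:
  assumes "open N" and "N \<subseteq> J"
  shows "open (\<phi> ` N)"
proof -
  have "\<phi> x \<in> interior (\<phi> ` N)" if "x \<in> N" for x
  proof (rule sussmann_open_mapping[OF open_J continuous_\<phi>])
    show "x \<in> J" using that assms by auto
    then show "(\<phi> has_derivative (\<lambda>h. \<sigma> * (w x * w x) * h)) (at x)"
      using d\<phi>[of x] by (simp add: has_field_derivative_def)
    show "bounded_linear (\<lambda>h. inverse (\<sigma> * (w x * w x)) * h)"
      by (rule bounded_linear_mult_right)
    show "(\<lambda>h. \<sigma> * (w x * w x) * h) \<circ> (\<lambda>h. inverse (\<sigma> * (w x * w x)) * h) = id"
      using w_nonzero[OF \<open>x \<in> J\<close>] \<sigma>_nonzero by (simp add: fun_eq_iff field_simps)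
    show "N \<subseteq> J" "x \<in> interior N" using assms that by (auto simp: interior_open)
  qed
  then have "interior (\<phi> ` N) = \<phi> ` N"
    using interior_subset by fastforce
  then show ?thesis by (metis open_interior)
qed

lemma open_interval_image: "open_interval (\<phi> ` J)"
proof -
  have "connected (\<phi> ` J)"
    using J continuous_\<phi> by (intro connected_continuous_image)
      (auto simp: open_interval_def is_interval_connected_1)
  then show ?thesis
    using J open_image[OF open_J] by (auto simp: open_interval_def is_interval_connected_1)
qed

text \<open>Chain rule through the inverse of \<open>\<phi>\<close>: the factor is dx/ds =
  1/(\<open>\<sigma>\<close> w^2), written \<open>\<sigma> / (w x * w x)\<close> because
  \<open>\<sigma> * \<sigma> = 1\<close>.\<close>

lemma has_vector_derivative_new_variable:
  fixes f :: "real \<Rightarrow> 'b::real_normed_vector"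
  assumes "open N" and "N \<subseteq> J" and "x \<in> N"
    and "(f has_vector_derivative f') (at x)"
    and "\<And>t. t \<in> N \<Longrightarrow> z (\<phi> t) = f t"
  shows "(z has_vector_derivative ((\<sigma> / (w x * w x)) *\<^sub>R f')) (at (\<phi> x))"
proof -
  define g where "g = the_inv_into J \<phi>"
  have "x \<in> J" using assms by auto
  have g: "g (\<phi> t) = t" if "t \<in> J" for t
    using that by (simp add: g_def the_inv_into_f_f[OF inj_\<phi>])
  have "(g has_derivative (\<lambda>h. (\<sigma> / (w x * w x)) * h)) (at (\<phi> x))"
  proof (rule has_derivative_inverse_strong[OF open_J \<open>x \<in> J\<close> continuous_\<phi> g])
    show "(\<phi> has_derivative (\<lambda>h. \<sigma> * (w x * w x) * h)) (at x)"
      using d\<phi>[OF \<open>x \<in> J\<close>] by (simp add: has_field_derivative_def)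
    show "(\<lambda>h. \<sigma> * (w x * w x) * h) \<circ> (\<lambda>h. (\<sigma> / (w x * w x)) * h) = id"
      using w_nonzero[OF \<open>x \<in> J\<close>] \<sigma> by (auto simp: fun_eq_iff field_simps)
  qed
  then have "(g has_vector_derivative (\<sigma> / (w x * w x))) (at (\<phi> x))"
    by (simp add: has_vector_derivative_def mult.commute)
  moreover have "(f has_vector_derivative f') (at (g (\<phi> x)))"
    using assms(4) g[OF \<open>x \<in> J\<close>] by simp
  ultimately have "((f \<circ> g) has_vector_derivative ((\<sigma> / (w x * w x)) *\<^sub>R f')) (at (\<phi> x))"
    by (rule vector_diff_chain_at)
  then show ?thesis
    by (rule has_vector_derivative_transform_within_open[OF _ open_image[OF assms(1,2)]])
      (use assms g in auto)
qed

text \<open>Differentiating z = w y twice in s gives z'' = (k2^2 - k1 k3) w y + w^(-3) y''. Since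
  \<open>\<xi>\<close>^2 w = w^(-3), the right-hand side D z is the same expression with y''
  replaced by C y.\<close>

lemma carries_linear:
  fixes C D :: "real \<Rightarrow> real^'m^'m"
  assumes D: "\<And>x. x \<in> J \<Longrightarrow> D (\<phi> x) = (\<xi> x * \<xi> x) *\<^sub>R C x + (k2 * k2 - k1 * k3) *\<^sub>R mat 1"
  shows "carries (J \<times> UNIV) (\<lambda>(x, y). (\<phi> x, w x *\<^sub>R y)) (linear_rhs C) (linear_rhs D)"
  unfolding carries_def
proof (intro allI impI ballI)
  fix N :: "real set" and y z :: "real \<Rightarrow> real^'m" and a
  assume asm: "open_interval N \<and> smooth_on N y \<and> (\<forall>x\<in>N. (x, y x) \<in> J \<times> UNIV \<and>
    deriv (\<lambda>t. fst ((\<lambda>(x, y). (\<phi> x, w x *\<^sub>R y)) (t, y t))) x \<noteq> 0 \<and>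
    z (fst ((\<lambda>(x, y). (\<phi> x, w x *\<^sub>R y)) (x, y x))) = snd ((\<lambda>(x, y). (\<phi> x, w x *\<^sub>R y)) (x, y x)))"
    and "a \<in> N"
  have oN: "open N" and NJ: "N \<subseteq> J" and z: "\<And>t. t \<in> N \<Longrightarrow> z (\<phi> t) = w t *\<^sub>R y t"
    using asm by (auto simp: open_interval_def)
  have "a \<in> J" using \<open>a \<in> N\<close> NJ by auto
  define y1 where "y1 x = frechet_derivative y (at x) 1" for x
  define y2 where "y2 x = frechet_derivative y1 (at x) 1" for x
  have y1: "(y has_vector_derivative y1 x) (at x)" if "x \<in> N" for x
    unfolding y1_def using asm that by (intro smooth_on_has_vector_derivative[of N]) auto
  have y2: "(y1 has_vector_derivative y2 x) (at x)" if "x \<in> N" for x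
    unfolding y2_def using asm that smooth_on_derivative[of N y]
    by (intro smooth_on_has_vector_derivative[of N]) (auto simp: y1_def[abs_def])
  \<comment> \<open>dz/ds as a function of x, that is \<open>\<sigma>\<close>/w^2 times the
    x-derivative of w y; \<open>z1\<close> is the same as a function of s.\<close>
  define f1 where "f1 x = (- (k1 * x + k2) * w x) *\<^sub>R y x + (\<sigma> / w x) *\<^sub>R y1 x" for x
  define z1 where "z1 = f1 \<circ> the_inv_into J \<phi>"
  have z1: "z1 (\<phi> t) = f1 t" if "t \<in> N" for t
    using that NJ by (auto simp: z1_def the_inv_into_f_f[OF inj_\<phi>])
  have dz: "(z has_vector_derivative z1 (\<phi> x)) (at (\<phi> x))" if "x \<in> N" for x
  proof -
    have "x \<in> J" using that NJ by auto
    have "((\<lambda>x. w x *\<^sub>R y x) has_vector_derivative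
        w x *\<^sub>R y1 x + (- \<sigma> * (k1 * x + k2) * (w x * w x * w x)) *\<^sub>R y x) (at x)"
      by (rule has_vector_derivative_scaleR[OF dw[OF \<open>x \<in> J\<close>] y1[OF that]])
    from has_vector_derivative_new_variable[OF oN NJ that this z]
    have "(z has_vector_derivative (\<sigma> / (w x * w x)) *\<^sub>R (w x *\<^sub>R y1 x +
        (- \<sigma> * (k1 * x + k2) * (w x * w x * w x)) *\<^sub>R y x)) (at (\<phi> x))" .
    moreover have "(\<sigma> / (w x * w x)) * (- \<sigma> * (k1 * x + k2) * (w x * w x * w x)) =
        (\<sigma> * \<sigma>) * (- (k1 * x + k2) * w x)"
      using w_nonzero[OF \<open>x \<in> J\<close>] by (simp add: field_simps)
    ultimately show ?thesis
      unfolding z1[OF that] f1_def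
      by (simp only: scaleR_add_right scaleR_scaleR \<sigma> mult_1_left) (simp add: add.commute w_nonzero[OF \<open>x \<in> J\<close>])
  qed
  have "\<forall>\<^sub>F t in nhds (\<phi> a). (z has_vector_derivative z1 t) (at t)"
    unfolding eventually_nhds using open_image[OF oN NJ] dz \<open>a \<in> N\<close> by blast
  moreover have "(z1 has_vector_derivative
      (((k2 * k2 - k1 * k3) * w a) *\<^sub>R y a + (1 / (w a * w a * w a)) *\<^sub>R y2 a)) (at (\<phi> a))"
  proof -
    define q where "q = k1 * a + k2"
    have "(f1 has_vector_derivative
        ((\<sigma> * (q * q) * (w a * w a * w a) - k1 * w a) *\<^sub>R y a + (\<sigma> / w a) *\<^sub>R y2 a)) (at a)"
    proof -
      have A: "((\<lambda>x. - (k1 * x + k2) * w x) has_real_derivative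
          (- k1 * w a + \<sigma> * (q * q) * (w a * w a * w a))) (at a)"
        by (rule derivative_eq_intros refl dw[OF \<open>a \<in> J\<close>] | simp add: q_def algebra_simps)+
      have B: "((\<lambda>x. \<sigma> / w x) has_real_derivative (q * w a)) (at a)"
      proof -
        have "((\<lambda>x. \<sigma> / w x) has_real_derivative
           (\<sigma> * \<sigma>) * (q * w a)) (at a)"
          by (rule derivative_eq_intros refl dw[OF \<open>a \<in> J\<close>] w_nonzero[OF \<open>a \<in> J\<close>])+
            (use w_nonzero[OF \<open>a \<in> J\<close>] in \<open>simp add: q_def field_simps\<close>)
        then show ?thesis by (simp add: \<sigma>)
      qed
      \<comment> \<open>The two terms in \<open>y1 a\<close>, with coefficients
        \<open>- q * w a\<close> and \<open>q * w a\<close>, cancel: the new equation has no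
        first-order term.\<close>
      show ?thesis unfolding f1_def
        by (rule has_vector_derivative_eq_rhs[OF has_vector_derivative_add[OF
              has_vector_derivative_scaleR[OF A y1[OF \<open>a \<in> N\<close>]]
              has_vector_derivative_scaleR[OF B y2[OF \<open>a \<in> N\<close>]]]])
          (simp add: q_def algebra_simps)
    qed
    from has_vector_derivative_new_variable[OF oN NJ \<open>a \<in> N\<close> this z1]
    have "(z1 has_vector_derivative (\<sigma> / (w a * w a)) *\<^sub>R
        ((\<sigma> * (q * q) * (w a * w a * w a) - k1 * w a) *\<^sub>R y a + (\<sigma> / w a) *\<^sub>R y2 a)) (at (\<phi> a))" .
    moreover have "(\<sigma> / (w a * w a)) * (\<sigma> * (q * q) * (w a * w a * w a) - k1 * w a)
        = (k2 * k2 - k1 * k3) * w a"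
    proof -
      have "(\<sigma> / (w a * w a)) * (\<sigma> * (q * q) * (w a * w a * w a) - k1 * w a)
          = (\<sigma> * \<sigma>) * (q * q) * w a - k1 * w a * \<sigma> * (1 / (w a * w a))"
        using w_nonzero[OF \<open>a \<in> J\<close>] by (simp add: field_simps)
      also have "1 / (w a * w a) = \<sigma> * \<xi> a"
        using w[OF \<open>a \<in> J\<close>] w_nonzero[OF \<open>a \<in> J\<close>] by (simp add: field_simps)
      \<comment> \<open>The expression q^2 - k1 \<open>\<xi>\<close> a does not depend on
        \<open>a\<close>: it is the discriminant k2^2 - k1 k3 of the quadratic
        \<open>\<xi>\<close>.\<close>
      also have "(\<sigma> * \<sigma>) * (q * q) * w a - k1 * w a * \<sigma> * (\<sigma> * \<xi> a)
          = (\<sigma> * \<sigma>) * ((k2 * k2 - k1 * k3) * w a)"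
        by (simp add: q_def algebra_simps)
      finally show ?thesis by (simp add: \<sigma>)
    qed
    moreover have "(\<sigma> / (w a * w a)) * (\<sigma> / w a) = 1 / (w a * w a * w a)"
      using \<sigma> by simp
    ultimately show ?thesis by (simp only: scaleR_add_right scaleR_scaleR)
  qed
  ultimately have "satisfies_at (linear_rhs D) z (\<phi> a) \<longleftrightarrow>
      ((k2 * k2 - k1 * k3) * w a) *\<^sub>R y a + (1 / (w a * w a * w a)) *\<^sub>R y2 a
      = linear_rhs D (\<phi> a) (z (\<phi> a))"
    by (rule satisfies_at_iff)
  also have "linear_rhs D (\<phi> a) (z (\<phi> a)) =
      ((k2 * k2 - k1 * k3) * w a) *\<^sub>R y a + (1 / (w a * w a * w a)) *\<^sub>R (C a *v y a)"
  proof -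
    \<comment> \<open>For \<open>X = \<xi> a\<close> both parenthesised factors on the right equal
      1.\<close>
    have "(\<sigma> * \<sigma>) * ((X * X) * w a) = (\<sigma> * X * (w a * w a)) * (\<sigma> * X * (w a * w a)) / (w a * w a * w a)"
      for X using w_nonzero[OF \<open>a \<in> J\<close>] by (simp add: field_simps)
    from this[of "\<xi> a"] have "(\<xi> a * \<xi> a) * w a = 1 / (w a * w a * w a)"
      unfolding w[OF \<open>a \<in> J\<close>] by (simp add: \<sigma>)
    moreover have "(c *\<^sub>R M + d *\<^sub>R mat 1) *v (e *\<^sub>R v) = (d * e) *\<^sub>R v + (c * e) *\<^sub>R (M *v v)"
      for c d e and M :: "real^'m^'m" and v
      by (simp add: matrix_vector_mult_add_rdistrib matrix_vector_mult_scaleR scaleR_add_right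
          mult.commute flip: scaleR_matrix_vector_assoc)
    ultimately show ?thesis
      unfolding linear_rhs_def D[OF \<open>a \<in> J\<close>] z[OF \<open>a \<in> N\<close>] by metis
  qed
  also have "(((k2 * k2 - k1 * k3) * w a) *\<^sub>R y a + (1 / (w a * w a * w a)) *\<^sub>R y2 a =
      ((k2 * k2 - k1 * k3) * w a) *\<^sub>R y a + (1 / (w a * w a * w a)) *\<^sub>R (C a *v y a)) \<longleftrightarrow>
      y2 a = C a *v y a"
    using w_nonzero[OF \<open>a \<in> J\<close>] by simp
  also have "\<dots> \<longleftrightarrow> satisfies_at (linear_rhs C) y a"
  proof -
    have "\<forall>\<^sub>F t in nhds a. (y has_vector_derivative y1 t) (at t)"
      unfolding eventually_nhds using oN y1 \<open>a \<in> N\<close> by blast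
    from satisfies_at_iff[OF this y2[OF \<open>a \<in> N\<close>], of "linear_rhs C"] show ?thesis
      by (simp add: linear_rhs_def)
  qed
  finally show "satisfies_at (linear_rhs C) y a \<longleftrightarrow> satisfies_at (linear_rhs D) z
      (fst ((\<lambda>(x, y). (\<phi> x, w x *\<^sub>R y)) (a, y a)))"
    by simp
qed

section \<open>The straightening as an admissible transformation\<close>

lemma smooth_w: "smooth_on J w"
proof -
  have "Ck_on k J w" for k
  proof (induction k)
    case 0
    then show ?case using dw by (auto intro!: continuous_at_imp_continuous_on DERIV_isCont)
  next
    case (Suc k)
    \<comment> \<open>Bootstrapping: the derivative of \<open>w\<close> is a polynomial in
      \<open>x\<close> and \<open>w\<close>, hence as regular as \<open>w\<close> itself.\<close>
    show ?case
    proof (rule Ck_on_SucI[OF open_J])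
      show "(w has_derivative (\<lambda>v. (- \<sigma> * (k1 * x + k2) * (w x * w x * w x)) * v)) (at x)"
        if "x \<in> J" for x
        using dw[OF that] unfolding has_field_derivative_def .
      have "Ck_on k J (\<lambda>x. x)"
        by (rule Ck_on_bounded_linear[OF open_J bounded_linear_ident])
      then show "Ck_on k J (\<lambda>x. - \<sigma> * (k1 * x + k2) * (w x * w x * w x) * v)" for v
        using Suc by (intro Ck_on_mult Ck_on_add Ck_on_const open_J)
    qed
  qed
  then show ?thesis by (simp add: smooth_on_def)
qed

lemma smooth_\<phi>: "smooth_on J \<phi>"
proof -
  have "Ck_on (Suc k) J \<phi>" for k
  proof (rule Ck_on_SucI[OF open_J])
    show "(\<phi> has_derivative (\<lambda>v. \<sigma> * (w x * w x) * v)) (at x)" if "x \<in> J" for x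
      using d\<phi>[OF that] by (simp add: has_field_derivative_def)
    show "Ck_on k J (\<lambda>x. \<sigma> * (w x * w x) * v)" for v
      using smooth_w by (intro Ck_on_mult Ck_on_const open_J) (auto simp: smooth_on_def)
  qed
  then show ?thesis using Ck_on_Suc_imp unfolding smooth_on_def by blast
qed

lemma point_transformation:
  "point_transformation (J \<times> UNIV) (\<lambda>(x, y :: real^'m). (\<phi> x, w x *\<^sub>R y))"
  unfolding point_transformation_def
proof (intro conjI ballI)
  let ?T = "\<lambda>(x, y :: real^'m). (\<phi> x, w x *\<^sub>R y)"
  have oU: "open (J \<times> (UNIV :: (real^'m) set))" by (simp add: open_J open_Times)
  then show "open (J \<times> (UNIV :: (real^'m) set))" .
  show "J \<times> (UNIV :: (real^'m) set) \<noteq> {}" using J by (auto simp: open_interval_def)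
  \<comment> \<open>Writing the map as a sum of scalar functions of x times constant or linear maps
    reduces its smoothness to the closure rules for \<open>Ck_on\<close>.\<close>
  have T_eq: "?T = (\<lambda>p. \<phi> (fst p) *\<^sub>R (1, 0) + w (fst p) *\<^sub>R (0, snd p))"
    by (auto simp: fun_eq_iff)
  have "bounded_linear (\<lambda>p. (0, snd p) :: real \<times> (real^'m))"
    by (intro bounded_linear_Pair bounded_linear_zero bounded_linear_snd)
  note bl = Ck_on_bounded_linear[OF oU this]
  have "Ck_on k J \<phi>" "Ck_on k J w" for k
    using smooth_\<phi> smooth_w by (auto simp: smooth_on_def)
  note this[THEN Ck_on_compose_fst[OF open_J]]
  then show "smooth_on (J \<times> UNIV) ?T"
    unfolding smooth_on_def T_eq
    by (intro allI Ck_on_add[OF oU] Ck_on_scaleR[OF oU] Ck_on_const[OF oU] bl)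
  show "inj_on ?T (J \<times> UNIV)"
    using inj_\<phi> w_nonzero by (auto simp: inj_on_def)
  fix p :: "real \<times> (real^'m)"
  assume "p \<in> J \<times> UNIV"
  then have "fst p \<in> J" by auto
  let ?x = "fst p"
  \<comment> \<open>The Jacobian is block triangular, with the nonzero diagonal entries
    \<open>\<sigma>\<close> w^2 and w; hence it is injective.\<close>
  let ?T' = "\<lambda>h. (\<sigma> * (w ?x * w ?x) * fst h,
    w ?x *\<^sub>R snd h + (- \<sigma> * (k1 * ?x + k2) * (w ?x * w ?x * w ?x) * fst h) *\<^sub>R snd p)"
  have d: "(?T has_derivative ?T') (at p)"
  proof -
    have \<Phi>: "((\<lambda>p. \<phi> (fst p)) has_derivative (\<lambda>h. \<sigma> * (w ?x * w ?x) * fst h)) (at p)"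
      using has_derivative_compose[OF has_derivative_fst[OF has_derivative_ident]
          d\<phi>[OF \<open>?x \<in> J\<close>, unfolded has_field_derivative_def]] by simp
    have W: "((\<lambda>p. w (fst p)) has_derivative
        (\<lambda>h. - \<sigma> * (k1 * ?x + k2) * (w ?x * w ?x * w ?x) * fst h)) (at p)"
      using has_derivative_compose[OF has_derivative_fst[OF has_derivative_ident]
          dw[OF \<open>?x \<in> J\<close>, unfolded has_field_derivative_def]] by simp
    have "((\<lambda>p. (\<phi> (fst p), w (fst p) *\<^sub>R snd p)) has_derivative ?T') (at p)"
      by (intro has_derivative_Pair \<Phi> has_derivative_scaleR[OF W] has_derivative_snd has_derivative_ident)
    then show ?thesis by (simp add: case_prod_unfold)
  qed
  have "inj ?T'"
  proof (rule injI)
    fix h h' assume eq: "?T' h = ?T' h'"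
    then have "fst h = fst h'" using \<sigma>_nonzero w_nonzero[OF \<open>?x \<in> J\<close>] by simp
    moreover from this eq have "snd h = snd h'" using w_nonzero[OF \<open>?x \<in> J\<close>] by simp
    ultimately show "h = h'" by (rule prod_eqI)
  qed
  then show "inj (frechet_derivative ?T (at p))"
    using frechet_derivative_at[OF d] by simp
qed

text \<open>The side condition on rescalings holds because the derivative of \<open>\<phi>\<close>
  is \<open>\<sigma>\<close> w^2, whose logarithmic derivative is 2 w'/w.\<close>

lemma equivalent_to_new_variables:
  fixes C D :: "real \<Rightarrow> real^'m^'m"
  assumes "J \<subseteq> I"
    and D: "\<And>x. x \<in> J \<Longrightarrow> D (\<phi> x) = (\<xi> x * \<xi> x) *\<^sub>R C x + (k2 * k2 - k1 * k3) *\<^sub>R mat 1"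
  shows "equivalent_to (I, linear_rhs C) (\<phi> ` J, linear_rhs D)"
proof -
  have "elementary_equiv (I, linear_rhs C) (J, linear_rhs C)"
    using J assms(1) by (rule elementary_equiv.restriction)
  moreover have "elementary_equiv (J, linear_rhs C) (\<phi> ` J, linear_rhs D)"
  proof (rule elementary_equiv.rescaling[OF smooth_\<phi> smooth_w _ carries_linear[OF D]])
    show "\<forall>x\<in>J. deriv \<phi> x \<noteq> 0 \<and> w x \<noteq> 0 \<and>
        deriv (deriv \<phi>) x / deriv \<phi> x = 2 * deriv w x / w x"
    proof
      fix x assume "x \<in> J"
      have "((\<lambda>x. \<sigma> * (w x * w x)) has_real_derivative
          \<sigma> * (2 * w x * (- \<sigma> * (k1 * x + k2) * (w x * w x * w x)))) (at x)"
        by (rule derivative_eq_intros refl dw[OF \<open>x \<in> J\<close>] | simp)+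
      then have "(deriv \<phi> has_real_derivative
          \<sigma> * (2 * w x * (- \<sigma> * (k1 * x + k2) * (w x * w x * w x)))) (at x)"
        by (rule has_field_derivative_transform_within_open[OF _ open_J \<open>x \<in> J\<close>])
          (use d\<phi> DERIV_imp_deriv in fastforce)
      then show "deriv \<phi> x \<noteq> 0 \<and> w x \<noteq> 0 \<and>
          deriv (deriv \<phi>) x / deriv \<phi> x = 2 * deriv w x / w x"
        using \<sigma>_nonzero w_nonzero[OF \<open>x \<in> J\<close>] DERIV_imp_deriv[OF d\<phi>[OF \<open>x \<in> J\<close>]]
          DERIV_imp_deriv[OF dw[OF \<open>x \<in> J\<close>]] by (simp add: DERIV_imp_deriv)
    qed
  qed
  ultimately show ?thesis
    unfolding equivalent_to_def by (rule converse_rtranclp_into_rtranclp[OF _ r_into_rtranclp])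
qed

text \<open>Where irreducibility enters: with a constant \<open>K\<close> the straightening itself
  is a point transformation to constant coefficients.\<close>

lemma not_irreducible_if_constant:
  fixes C :: "real \<Rightarrow> real^'m^'m"
  assumes "J \<subseteq> I"
    and K: "\<And>x. x \<in> J \<Longrightarrow> K = (\<xi> x * \<xi> x) *\<^sub>R C x + (k2 * k2 - k1 * k3) *\<^sub>R mat 1"
  shows "\<not> irreducible_system (I, linear_rhs C)"
proof -
  have "carries (J \<times> UNIV) (\<lambda>(x, y). (\<phi> x, w x *\<^sub>R y)) (linear_rhs C) (linear_rhs (\<lambda>_. K))"
    using K by (rule carries_linear)
  then have "constant_coefficient_reducible (I, linear_rhs C)"
    unfolding constant_coefficient_reducible_def
    using point_transformation assms(1) by (auto intro!: exI[of _ "J \<times> UNIV"])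
  then show ?thesis by (simp add: irreducible_system_def reducible_def)
qed

end

section \<open>Generators\<close>

text \<open>The general element k1 X1 + k2 X2 + k3 X3 + X_A in one formula, so that brackets,
  prolongations and determining equations are computed only once.\<close>

definition gen :: "real \<Rightarrow> real \<Rightarrow> real \<Rightarrow> real^'m^'m \<Rightarrow> 'm::finite vfield" where
  "gen k1 k2 k3 A = (\<lambda>(x, y). (k1 * (x * x) + 2 * k2 * x + k3, (k1 * x + k2) *\<^sub>R y + A *v y))"

lemma generator_eq_gen:
  "X1 \<oplus>\<^sub>v XA A = gen 1 0 0 A"
  "X2 \<oplus>\<^sub>v XA A = gen 0 1 0 A"
  "X3 \<oplus>\<^sub>v XA A = gen 0 0 1 A"
  "X1 \<oplus>\<^sub>v X3 \<oplus>\<^sub>v XA A = gen 1 0 1 A"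
  by (auto simp: fun_eq_iff vadd_def X1_def X2_def X3_def XA_def gen_def)

lemma has_derivative_gen:
  fixes A :: "real^'m^'m"
  shows "(gen k1 k2 k3 A has_derivative
    (\<lambda>h. (2 * (k1 * x + k2) * fst h, (k1 * fst h) *\<^sub>R y + (k1 * x + k2) *\<^sub>R snd h + A *v snd h))) (at (x, y))"
proof -
  have "((\<lambda>p. (k1 * (fst p * fst p) + 2 * k2 * fst p + k3, (k1 * fst p + k2) *\<^sub>R snd p + A *v snd p))
    has_derivative
    (\<lambda>h. (2 * (k1 * x + k2) * fst h, (k1 * fst h) *\<^sub>R y + (k1 * x + k2) *\<^sub>R snd h + A *v snd h))) (at (x, y))"
    by (auto intro!: derivative_eq_intros bounded_linear.has_derivative[OF matrix_vector_mul_bounded_linear]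
        simp: fun_eq_iff algebra_simps)
  then show ?thesis by (simp add: gen_def case_prod_unfold)
qed

lemma gen_add: "gen k1 k2 k3 A w + gen l1 l2 l3 B w = gen (k1 + l1) (k2 + l2) (k3 + l3) (A + B) w"
  by (cases w) (simp add: gen_def algebra_simps)

lemma gen_diff: "gen k1 k2 k3 A w - gen l1 l2 l3 B w = gen (k1 - l1) (k2 - l2) (k3 - l3) (A - B) w"
  by (cases w) (simp add: gen_def algebra_simps)

lemma gen_scaleR: "c *\<^sub>R gen k1 k2 k3 A w = gen (c * k1) (c * k2) (c * k3) (c *\<^sub>R A) w"
  by (cases w) (simp add: gen_def algebra_simps flip: scaleR_matrix_vector_assoc)

text \<open>The matrix part is \<open>B ** A - A ** B\<close> because passing from matrices to
  linear vector fields reverses the sign of commutators.\<close>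

lemma lie_bracket_gen:
  "lie_bracket (gen k1 k2 k3 A) (gen l1 l2 l3 B) =
   gen (2 * (l1 * k2 - k1 * l2)) (l1 * k3 - k1 * l3) (2 * (l2 * k3 - k2 * l3)) (B ** A - A ** B)"
proof
  fix p :: "real \<times> (real^'a)"
  obtain x y where p: "p = (x, y)" by fastforce
  show "lie_bracket (gen k1 k2 k3 A) (gen l1 l2 l3 B) p =
   gen (2 * (l1 * k2 - k1 * l2)) (l1 * k3 - k1 * l3) (2 * (l2 * k3 - k2 * l3)) (B ** A - A ** B) p"
    unfolding lie_bracket_def p frechet_derivative_at[OF has_derivative_gen, symmetric]
    by (simp add: gen_def algebra_simps matrix_vector_mul_assoc)
qed

text \<open>Three points \<open>a - e\<close>, \<open>a\<close>, \<open>a + e\<close> suffice: the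
  second difference isolates \<open>k1\<close>, and the lower coefficients follow in turn.\<close>

lemma quadratic_eq_zero_on_interval:
  assumes "open_interval I" and "\<And>x. x \<in> I \<Longrightarrow> k1 * (x * x) + 2 * k2 * x + k3 = (0::real)"
  shows "k1 = 0" "k2 = 0" "k3 = 0"
proof -
  obtain a where "a \<in> I" using assms(1) by (auto simp: open_interval_def)
  then obtain e where "0 < e" and e: "cball a e \<subseteq> I"
    using assms(1) open_contains_cball by (metis open_interval_def)
  have "a + e \<in> I" "a - e \<in> I" using e \<open>0 < e\<close> by (auto simp: dist_real_def subset_iff)
  note eqs = assms(2)[OF \<open>a \<in> I\<close>] assms(2)[OF this(1)] assms(2)[OF this(2)]
  have "2 * (k1 * (e * e)) = (k1 * ((a + e) * (a + e)) + 2 * k2 * (a + e) + k3)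
      + (k1 * ((a - e) * (a - e)) + 2 * k2 * (a - e) + k3) - 2 * (k1 * (a * a) + 2 * k2 * a + k3)"
    by (simp add: algebra_simps)
  then show "k1 = 0" using eqs \<open>0 < e\<close> by simp
  then have "2 * k2 * e = 0" using eqs by (simp add: algebra_simps)
  then show "k2 = 0" using \<open>0 < e\<close> by simp
  then show "k3 = 0" using eqs \<open>k1 = 0\<close> by simp
qed

text \<open>The first component gives the vanishing quadratic; in the second, \<open>y = 0\<close>
  shows \<open>h a = 0\<close>, so \<open>A\<close> acts as a scalar. Trivial generators thus cost
  only multiples of \<open>mat 1\<close>.\<close>

lemma trivial_generator_genD:
  fixes A :: "real^'m^'m"
  assumes "open_interval I" and "trivial_generator (I, F) (gen k1 k2 k3 A)"
  shows "k1 = 0" "k2 = 0" "k3 = 0" "\<exists>c. A = c *\<^sub>R mat 1"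
proof -
  obtain c h where ch: "\<And>x y. x \<in> I \<Longrightarrow> gen k1 k2 k3 A (x, y) = (0, c *\<^sub>R y + h x)"
    using assms(2) by (auto simp: trivial_generator_def)
  have "k1 * (x * x) + 2 * k2 * x + k3 = 0" if "x \<in> I" for x
    using ch[OF that] by (simp add: gen_def)
  from quadratic_eq_zero_on_interval[OF assms(1) this]
  show k: "k1 = 0" "k2 = 0" "k3 = 0" by auto
  obtain a where "a \<in> I" using assms(1) by (auto simp: open_interval_def)
  from ch[OF this] have *: "A *v y = c *\<^sub>R y + h a" for y
    by (simp add: gen_def k)
  from *[of 0] have "h a = 0" by simp
  with * have "\<forall>y. A *v y = (c *\<^sub>R mat 1) *v y"
    by (simp flip: scaleR_matrix_vector_assoc)
  then show "\<exists>c. A = c *\<^sub>R mat 1" by (auto simp: matrix_eq)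
qed

lemma trivial_generator_zero: "trivial_generator (I, linear_rhs C) (\<lambda>_. 0)"
  unfolding trivial_generator_def
  by (auto intro!: exI[of _ 0] exI[of _ "\<lambda>_. 0"] satisfies_at_zero simp: zero_prod_def)

section \<open>Prolongation and the determining equation\<close>

lemma bounded_bilinear_matrix_vector_mult:
  "bounded_bilinear ((*v) :: real^'m^'n \<Rightarrow> real^'m \<Rightarrow> real^'n)"
proof -
  have "bilinear ((*v) :: real^'m^'n \<Rightarrow> real^'m \<Rightarrow> real^'n)"
    unfolding bilinear_def linear_iff
    by (simp add: matrix_vector_mult_add_rdistrib matrix_vector_right_distrib
        matrix_vector_mult_scaleR flip: scaleR_matrix_vector_assoc)
  then show ?thesis by (simp add: bilinear_conv_bounded_bilinear)
qed

lemma prolong1_gen: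
  "prolong1 (gen k1 k2 k3 A) = (\<lambda>(x, y, p). k1 *\<^sub>R y + A *v p - (k1 * x + k2) *\<^sub>R p)"
proof -
  have "frechet_derivative (\<lambda>w. fst (gen k1 k2 k3 A w)) (at (x, y)) =
      (\<lambda>h. 2 * (k1 * x + k2) * fst h)" for x and y :: "real^'a"
    using has_derivative_fst[OF has_derivative_gen[of k1 k2 k3 A x y]]
    by (simp flip: frechet_derivative_at)
  moreover have "frechet_derivative (\<lambda>w. snd (gen k1 k2 k3 A w)) (at (x, y)) =
      (\<lambda>h. (k1 * fst h) *\<^sub>R y + (k1 * x + k2) *\<^sub>R snd h + A *v snd h)" for x and y :: "real^'a"
    using has_derivative_snd[OF has_derivative_gen[of k1 k2 k3 A x y]]
    by (simp flip: frechet_derivative_at)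
  ultimately show ?thesis
    by (simp add: prolong1_def fun_eq_iff vec_eq_iff algebra_simps)
qed

text \<open>The two terms \<open>k1 *\<^sub>R p\<close> cancel in the second prolongation, which
  therefore depends on \<open>q\<close> and \<open>x\<close> only.\<close>

lemma prolong2_gen:
  "prolong2 (gen k1 k2 k3 A) = (\<lambda>(x, y, p, q). A *v q - (3 * (k1 * x + k2)) *\<^sub>R q)"
proof -
  have 1: "frechet_derivative (\<lambda>w. fst (gen k1 k2 k3 A w)) (at (x, y)) =
      (\<lambda>h. 2 * (k1 * x + k2) * fst h)" for x and y :: "real^'a"
    using has_derivative_fst[OF has_derivative_gen[of k1 k2 k3 A x y]]
    by (simp flip: frechet_derivative_at)
  have 2: "frechet_derivative (prolong1 (gen k1 k2 k3 A)) (at (x, y, p)) =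
      (\<lambda>h. k1 *\<^sub>R fst (snd h) + A *v snd (snd h) - (k1 * x + k2) *\<^sub>R snd (snd h) - (k1 * fst h) *\<^sub>R p)"
    for x and y p :: "real^'a"
  proof -
    have "((\<lambda>w. k1 *\<^sub>R fst (snd w) + A *v snd (snd w) - (k1 * fst w + k2) *\<^sub>R snd (snd w))
      has_derivative (\<lambda>h. k1 *\<^sub>R fst (snd h) + A *v snd (snd h)
         - (k1 * x + k2) *\<^sub>R snd (snd h) - (k1 * fst h) *\<^sub>R p)) (at (x, y, p))"
      by (auto intro!: derivative_eq_intros bounded_linear.has_derivative[OF matrix_vector_mul_bounded_linear]
          simp: fun_eq_iff algebra_simps)
    then show ?thesis
      unfolding prolong1_gen by (simp add: case_prod_unfold flip: frechet_derivative_at)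
  qed
  show ?thesis
    by (simp add: prolong2_def fun_eq_iff 1 2 vec_eq_iff algebra_simps)
qed

text \<open>Both sides of the symmetry condition are linear in \<open>y\<close>, so it is a matrix
  identity. The coefficient 4 is 3 from the prolongation plus 1 from the scalar part of the
  generator acting on \<open>y\<close>.\<close>

lemma admits_gen_iff:
  fixes C :: "real \<Rightarrow> real^'m^'m"
  assumes C': "\<And>x. x \<in> I \<Longrightarrow> (C has_vector_derivative C' x) (at x)"
  shows "admits (I, linear_rhs C) (gen k1 k2 k3 A) \<longleftrightarrow>
    (\<forall>x\<in>I. (k1 * (x * x) + 2 * k2 * x + k3) *\<^sub>R C' x + (C x ** A - A ** C x)
        + (4 * (k1 * x + k2)) *\<^sub>R C x = 0)"
proof -
  have F: "frechet_derivative (\<lambda>(x, y). linear_rhs C x y) (at (x, y)) =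
      (\<lambda>h. C x *v snd h + (fst h *\<^sub>R C' x) *v y)" if "x \<in> I" for x y
  proof -
    have "((\<lambda>p. C (fst p)) has_derivative (\<lambda>h. fst h *\<^sub>R C' x)) (at (x, y))"
    proof -
      have "(C has_derivative (\<lambda>h. h *\<^sub>R C' x)) (at (fst (x, y)))"
        using C'[OF that] by (simp add: has_vector_derivative_def)
      from has_derivative_compose[OF has_derivative_fst[OF has_derivative_ident] this]
      show ?thesis by simp
    qed
    from bounded_bilinear.FDERIV[OF bounded_bilinear_matrix_vector_mult this
        has_derivative_snd[OF has_derivative_ident]]
    have "((\<lambda>p. C (fst p) *v snd p) has_derivative
      (\<lambda>h. C x *v snd h + (fst h *\<^sub>R C' x) *v y)) (at (x, y))" by simp
    then show ?thesis
      by (simp add: linear_rhs_def case_prod_unfold flip: frechet_derivative_at)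
  qed
  have "prolong2 (gen k1 k2 k3 A) (x, y, p, linear_rhs C x y) =
        frechet_derivative (\<lambda>(x, y). linear_rhs C x y) (at (x, y)) (gen k1 k2 k3 A (x, y)) \<longleftrightarrow>
      ((k1 * (x * x) + 2 * k2 * x + k3) *\<^sub>R C' x + (C x ** A - A ** C x)
        + (4 * (k1 * x + k2)) *\<^sub>R C x) *v y = 0 *v y" if "x \<in> I" for x y p
  proof -
    define k where "k = k1 * (x * x) + 2 * k2 * x + k3"
    define l where "l = k1 * x + k2"
    have "A *v (C x *v y) - (3 * l) *\<^sub>R (C x *v y) = C x *v (l *\<^sub>R y + A *v y) + (k *\<^sub>R C' x) *v y \<longleftrightarrow>
       (k *\<^sub>R C' x + (C x ** A - A ** C x) + (4 * l) *\<^sub>R C x) *v y = 0 *v y" (is "?l = ?r1 \<longleftrightarrow> ?r2 = _")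
    proof -
      have "?r2 = ?r1 - ?l"
        by (simp add: matrix_vector_mult_add_rdistrib matrix_vector_mult_diff_rdistrib
            matrix_vector_right_distrib matrix_vector_mult_scaleR
            flip: scaleR_matrix_vector_assoc matrix_vector_mul_assoc)
          (simp flip: scaleR_add_left)
      then show ?thesis by auto
    qed
    moreover have "gen k1 k2 k3 A (x, y) = (k, l *\<^sub>R y + A *v y)"
      by (simp add: gen_def k_def l_def)
    moreover have "prolong2 (gen k1 k2 k3 A) (x, y, p, q) = A *v q - (3 * l) *\<^sub>R q" for q
      by (simp add: prolong2_gen l_def)
    ultimately show ?thesis
      unfolding F[OF that] k_def[symmetric] l_def[symmetric] by (simp add: linear_rhs_def)
  qed
  then show ?thesis
    unfolding admits_def by (simp add: matrix_eq)
qed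


section \<open>Lie algebras from commutation relations\<close>

lemma admits_lie_algebraI:
  fixes C :: "real \<Rightarrow> real^'m^'m"
  assumes "finite B" and "\<And>V. V \<in> B \<Longrightarrow> admits (I, linear_rhs C) V"
    and "\<And>c V. trivial_generator (I, linear_rhs C) (lincomb B c) \<Longrightarrow> V \<in> B \<Longrightarrow> c V = 0"
    and "\<And>V W. V \<in> B \<Longrightarrow> W \<in> B \<Longrightarrow> \<exists>c. lie_bracket V W = lincomb B c"
  shows "admits_lie_algebra (I, linear_rhs C) B"
  unfolding admits_lie_algebra_def
proof (intro conjI ballI)
  fix V W assume "V \<in> B" "W \<in> B"
  then obtain c where "lie_bracket V W = lincomb B c" using assms(4) by blast
  then have "trivial_generator (I, linear_rhs C) (\<lambda>w. lie_bracket V W w - lincomb B c w)"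
    using trivial_generator_zero by simp
  then show "\<exists>c. trivial_generator (I, linear_rhs C) (\<lambda>w. lie_bracket V W w - lincomb B c w)"
    by blast
qed (use assms in auto)

text \<open>Keeps the members of a basis distinct as functions, so that sums over the basis set do
  not collapse and coefficients can be prescribed independently.\<close>

lemma gen_neq: "(k1, k2, k3) \<noteq> (l1, l2, l3) \<Longrightarrow> gen k1 k2 k3 A \<noteq> gen l1 l2 l3 B"
proof
  assume "(k1, k2, k3) \<noteq> (l1, l2, l3)" and eq: "gen k1 k2 k3 A = gen l1 l2 l3 B"
  have "(k1 - l1) * (x * x) + 2 * (k2 - l2) * x + (k3 - l3) = 0" for x
    using fun_cong[OF eq, of "(x, 0)"] by (simp add: gen_def algebra_simps)
  from quadratic_eq_zero_on_interval[OF open_interval_UNIV this] \<open>(k1, k2, k3) \<noteq> (l1, l2, l3)\<close>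
  show False by auto
qed

lemma lincomb_one: "lincomb {gen k1 k2 k3 A} c =
  (let a = c (gen k1 k2 k3 A) in gen (a * k1) (a * k2) (a * k3) (a *\<^sub>R A))"
  by (auto simp: lincomb_def Let_def gen_scaleR)

lemma lincomb_two: "lincomb {gen 0 1 0 A2, gen 0 0 1 A3} c =
  (let a2 = c (gen 0 1 0 A2); a3 = c (gen 0 0 1 A3) in gen 0 a2 a3 (a2 *\<^sub>R A2 + a3 *\<^sub>R A3))"
  by (auto simp: lincomb_def Let_def gen_scaleR gen_add gen_neq)

lemma lincomb_three: "lincomb {gen 1 0 0 A1, gen 0 1 0 A2, gen 0 0 1 A3} c =
  (let a1 = c (gen 1 0 0 A1); a2 = c (gen 0 1 0 A2); a3 = c (gen 0 0 1 A3)
   in gen a1 a2 a3 (a1 *\<^sub>R A1 + (a2 *\<^sub>R A2 + a3 *\<^sub>R A3)))"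
  by (auto simp: lincomb_def Let_def gen_scaleR gen_add gen_neq)

lemma admits_lie_algebra_one:
  assumes "open_interval I" and "admits (I, linear_rhs C) (gen k1 k2 k3 A)" and "(k1, k2, k3) \<noteq> (0, 0, 0)"
  shows "admits_lie_algebra (I, linear_rhs C) {gen k1 k2 k3 A}"
proof (rule admits_lie_algebraI)
  show "c V = 0" if "trivial_generator (I, linear_rhs C) (lincomb {gen k1 k2 k3 A} c)"
    "V \<in> {gen k1 k2 k3 A}" for c V
    using trivial_generator_genD[OF assms(1) that(1)[unfolded lincomb_one Let_def]] that(2) assms(3) by auto
  show "\<exists>c. lie_bracket V W = lincomb {gen k1 k2 k3 A} c"
    if "V \<in> {gen k1 k2 k3 A}" "W \<in> {gen k1 k2 k3 A}" for V W
    using that by (auto simp: lie_bracket_gen lincomb_one Let_def intro!: exI[of _ "\<lambda>_. 0"])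
qed (use assms in auto)

lemma admits_lie_algebra_two:
  fixes B2 B3 :: "real^'m^'m"
  assumes "open_interval I" and "admits (I, linear_rhs C) (gen 0 1 0 B2)"
    and "admits (I, linear_rhs C) (gen 0 0 1 B3)"
    and B: "B2 ** B3 - B3 ** B2 = 2 *\<^sub>R B3"
  shows "admits_lie_algebra (I, linear_rhs C) {gen 0 1 0 B2, gen 0 0 1 B3}" (is "admits_lie_algebra _ ?B")
proof (rule admits_lie_algebraI)
  show "c V = 0" if "trivial_generator (I, linear_rhs C) (lincomb ?B c)" "V \<in> ?B" for c V
    using trivial_generator_genD[OF assms(1) that(1)[unfolded lincomb_two Let_def]] that(2) by auto
  have B': "B3 ** B2 - B2 ** B3 = - 2 *\<^sub>R B3" using B by (metis minus_diff_eq scaleR_minus_left)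
  \<comment> \<open>Any pair of coefficients is realised by a function on the basis; the brackets
    that occur are zero and plus or minus twice the second generator.\<close>
  have ex: "\<exists>c. gen 0 a2 a3 (a2 *\<^sub>R B2 + a3 *\<^sub>R B3) = lincomb ?B c" for a2 a3
    by (rule exI[of _ "(\<lambda>_. 0)(gen 0 1 0 B2 := a2, gen 0 0 1 B3 := a3)"])
      (simp add: lincomb_two Let_def gen_neq)
  show "\<exists>c. lie_bracket V W = lincomb ?B c" if "V \<in> ?B" "W \<in> ?B" for V W
    using that ex[of 0 0] ex[of 0 2] ex[of 0 "-2"] by (auto simp: lie_bracket_gen B B')
qed (use assms in auto)

lemma admits_lie_algebra_three:
  fixes B1 B2 B3 :: "real^'m^'m"
  assumes "open_interval I" and "admits (I, linear_rhs C) (gen 1 0 0 B1)"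
    and "admits (I, linear_rhs C) (gen 0 1 0 B2)" and "admits (I, linear_rhs C) (gen 0 0 1 B3)"
    and B12: "B1 ** B2 - B2 ** B1 = 2 *\<^sub>R B1" and B13: "B1 ** B3 - B3 ** B1 = B2"
    and B23: "B2 ** B3 - B3 ** B2 = 2 *\<^sub>R B3"
  shows "admits_lie_algebra (I, linear_rhs C) {gen 1 0 0 B1, gen 0 1 0 B2, gen 0 0 1 B3}"
    (is "admits_lie_algebra _ ?B")
proof (rule admits_lie_algebraI)
  show "c V = 0" if "trivial_generator (I, linear_rhs C) (lincomb ?B c)" "V \<in> ?B" for c V
    using trivial_generator_genD[OF assms(1) that(1)[unfolded lincomb_three Let_def]] that(2) by auto
  have B': "B2 ** B1 - B1 ** B2 = - 2 *\<^sub>R B1" "B3 ** B1 - B1 ** B3 = - B2"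
    "B3 ** B2 - B2 ** B3 = - 2 *\<^sub>R B3"
    using B12 B13 B23 by (metis minus_diff_eq scaleR_minus_left)+
  have ex: "\<exists>c. gen a1 a2 a3 (a1 *\<^sub>R B1 + (a2 *\<^sub>R B2 + a3 *\<^sub>R B3)) = lincomb ?B c" for a1 a2 a3
    by (rule exI[of _ "(\<lambda>_. 0)(gen 1 0 0 B1 := a1, gen 0 1 0 B2 := a2, gen 0 0 1 B3 := a3)"])
      (simp add: lincomb_three Let_def gen_neq)
  show "\<exists>c. lie_bracket V W = lincomb ?B c" if "V \<in> ?B" "W \<in> ?B" for V W
    using that ex[of 0 0 0] ex[of 2 0 0] ex[of "-2" 0 0] ex[of 0 1 0] ex[of 0 "-1" 0] ex[of 0 0 2] ex[of 0 0 "-2"]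
    by (auto simp: lie_bracket_gen B12 B13 B23 B')
qed (use assms in auto)

section \<open>The normal forms\<close>

text \<open>Near \<open>a\<close> the product \<open>\<sigma> * \<xi> x\<close> stays positive, so
  \<open>w\<close> is its inverse square root and \<open>\<phi>\<close> an antiderivative of the
  continuous function \<open>\<sigma>\<close> w^2.\<close>

lemma ex_straightening:
  assumes I: "open_interval I" and a: "a \<in> I" "k1 * (a * a) + 2 * k2 * a + k3 \<noteq> 0"
  obtains J \<sigma> \<phi> w where "straightening J k1 k2 k3 \<sigma> \<phi> w" and "J \<subseteq> I"
proof -
  define \<xi> where "\<xi> x = k1 * (x * x) + 2 * k2 * x + k3" for x
  define \<sigma> where "\<sigma> = sgn (\<xi> a)"
  define w where "w x = 1 / sqrt (\<sigma> * \<xi> x)" for x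
  have \<sigma>: "\<sigma> * \<sigma> = 1" using a(2) by (simp add: \<sigma>_def \<xi>_def sgn_if)
  have cont: "continuous_on UNIV (\<lambda>x. \<sigma> * \<xi> x)"
    unfolding \<xi>_def by (intro continuous_intros)
  have "open (I \<inter> {x. 0 < \<sigma> * \<xi> x})"
    using I cont by (intro open_Int open_Collect_less continuous_on_const) (auto simp: open_interval_def)
  moreover have "a \<in> I \<inter> {x. 0 < \<sigma> * \<xi> x}"
    using a by (auto simp: \<sigma>_def \<xi>_def sgn_if zero_less_mult_iff)
  \<comment> \<open>A closed ball, because the antiderivative is taken on a compact interval;
    \<open>J\<close> is its interior.\<close>
  ultimately obtain e where e: "0 < e" "cball a e \<subseteq> I \<inter> {x. 0 < \<sigma> * \<xi> x}"
    using open_contains_cball by metis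
  have sub: "{a - e..a + e} \<subseteq> I" and pos: "\<And>x. x \<in> {a - e..a + e} \<Longrightarrow> 0 < \<sigma> * \<xi> x"
    using e(2) unfolding cball_eq_atLeastAtMost by auto
  define J where "J = {a - e<..<a + e}"
  have JK: "J \<subseteq> {a - e..a + e}" by (auto simp: J_def)
  have dw: "(w has_real_derivative (- \<sigma> * (k1 * x + k2) * (w x * w x * w x))) (at x)"
    if "0 < \<sigma> * \<xi> x" for x
  proof -
    define r where "r = sqrt (\<sigma> * \<xi> x)"
    have r: "r \<noteq> 0" using real_sqrt_gt_zero[OF that] unfolding r_def by linarith
    have "(\<xi> has_real_derivative 2 * (k1 * x + k2)) (at x)"
      unfolding \<xi>_def by (auto intro!: derivative_eq_intros simp: algebra_simps)
    then have D: "((\<lambda>x. sqrt (\<sigma> * \<xi> x)) has_real_derivative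
        (inverse r / 2) * (\<sigma> * (2 * (k1 * x + k2)))) (at x)"
      unfolding r_def
      by (rule DERIV_chain2[where f = sqrt and g = "\<lambda>x. \<sigma> * \<xi> x", OF DERIV_real_sqrt[OF that] DERIV_cmult])
    have "(w has_real_derivative
        - (inverse r * ((inverse r / 2) * (\<sigma> * (2 * (k1 * x + k2)))) * inverse r)) (at x)"
      using DERIV_inverse_fun[OF D] r unfolding w_def divide_inverse mult_1_left r_def[symmetric] by (simp add: ac_simps)
    moreover have "w x = inverse r" by (simp add: w_def r_def divide_inverse)
    ultimately show ?thesis by (simp add: algebra_simps)
  qed
  have "continuous_on {a - e..a + e} w"
    using DERIV_isCont[OF dw[OF pos]] by (intro continuous_at_imp_continuous_on ballI)
  then have "continuous_on {a - e..a + e} (\<lambda>x. \<sigma> * (w x * w x))"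
    by (intro continuous_intros)
  then obtain \<phi> where \<phi>: "\<And>x. x \<in> {a - e..a + e} \<Longrightarrow>
      (\<phi> has_vector_derivative (\<sigma> * (w x * w x))) (at x within {a - e..a + e})"
    by (rule antiderivative_continuous) (rule that)
  have "straightening J k1 k2 k3 \<sigma> \<phi> w"
  proof
    show "open_interval J" using e(1) by (simp add: J_def open_interval_def is_interval_oo)
    show "\<sigma> * \<sigma> = 1" by (rule \<sigma>)
    fix x assume "x \<in> J"
    then have "0 < \<sigma> * \<xi> x" using pos JK by auto
    then have "w x * w x = 1 / (\<sigma> * \<xi> x)" by (simp add: w_def)
    moreover have "\<sigma> * \<xi> x \<noteq> 0" using \<open>0 < \<sigma> * \<xi> x\<close> by linarith
    ultimately show "\<sigma> * (k1 * (x * x) + 2 * k2 * x + k3) * (w x * w x) = 1"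
      unfolding \<xi>_def[symmetric] by simp
    show "(w has_real_derivative (- \<sigma> * (k1 * x + k2) * (w x * w x * w x))) (at x)"
      by (rule dw) fact
    have "(\<phi> has_vector_derivative (\<sigma> * (w x * w x))) (at x within J)"
      using \<phi>[of x] JK \<open>x \<in> J\<close> by (intro has_vector_derivative_within_subset[OF _ JK]) auto
    moreover have "at x within J = at x"
      using \<open>x \<in> J\<close> by (rule at_within_open) (simp add: J_def)
    ultimately show "(\<phi> has_real_derivative (\<sigma> * (w x * w x))) (at x)"
      by (simp add: has_real_derivative_iff_has_vector_derivative)
  qed
  moreover have "J \<subseteq> I" using JK sub by auto
  ultimately show ?thesis by (rule that)
qed

lemma exp_conj_commuting:
  fixes A C0 :: "real^'m^'m"
  assumes "C0 ** A = A ** C0"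
  shows "exp_conj A C0 x = C0"
proof -
  have "((\<lambda>x. exp_conj A C0 x) has_vector_derivative 0) (at x)" for x
    using has_vector_derivative_exp_conj[OF has_vector_derivative_const[of C0], of A x] assms
    by (simp add: exp_conj_def matmul_simps)
  from has_vector_derivative_zero_eq[OF open_interval_UNIV this, of x 0] show ?thesis
    by (simp add: exp_conj_zero)
qed

lemma has_vector_derivative_exp_conj':
  fixes A C0 :: "real^'m^'m"
  shows "((\<lambda>x. exp_conj A C0 x) has_vector_derivative (A ** exp_conj A C0 x - exp_conj A C0 x ** A)) (at x)"
  using has_vector_derivative_exp_conj[OF has_vector_derivative_const[of C0], of A x]
  by (simp add: exp_conj_diff exp_conj_mult exp_conj_self)

lemma admits_exp_conj_iff:
  fixes A B C0 :: "real^'m^'m"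
  shows "admits (I, linear_rhs (exp_conj A C0)) (gen k1 k2 k3 B) \<longleftrightarrow>
    (\<forall>x\<in>I. (k1 * (x * x) + 2 * k2 * x + k3) *\<^sub>R (A ** exp_conj A C0 x - exp_conj A C0 x ** A)
      + (exp_conj A C0 x ** B - B ** exp_conj A C0 x) + (4 * (k1 * x + k2)) *\<^sub>R exp_conj A C0 x = 0)"
  by (rule admits_gen_iff) (rule has_vector_derivative_exp_conj')

lemma normal_form_one:
  fixes C :: "real \<Rightarrow> real^'m^'m"
  assumes I: "open_interval I" and "smooth_on I C" and irr: "irreducible_system (I, linear_rhs C)"
    and adm: "admits (I, linear_rhs C) (gen k1 k2 k3 A)"
    and k: "(k1, k2, k3) \<noteq> (0, 0, 0)"
  shows "\<exists>J A C0. open_interval J \<and> equivalent_to (I, linear_rhs C) (J, linear_rhs (exp_conj A C0)) \<and>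
    C0 ** A - A ** C0 \<noteq> 0 \<and> admits_lie_algebra (J, linear_rhs (exp_conj A C0)) {gen 0 0 1 A}"
proof -
  have "\<exists>a\<in>I. k1 * (a * a) + 2 * k2 * a + k3 \<noteq> 0"
  proof (rule ccontr)
    assume "\<not> ?thesis"
    then have "k1 * (a * a) + 2 * k2 * a + k3 = 0" if "a \<in> I" for a using that by blast
    note quadratic_eq_zero_on_interval[OF I this]
    then show False using k by auto
  qed
  then obtain a where "a \<in> I" "k1 * (a * a) + 2 * k2 * a + k3 \<noteq> 0" by blast
  then obtain J \<sigma> \<phi> w where "straightening J k1 k2 k3 \<sigma> \<phi> w" and "J \<subseteq> I"
    by (rule ex_straightening[OF I])
  then interpret straightening J k1 k2 k3 \<sigma> \<phi> w by simp
  define C' where "C' x = frechet_derivative C (at x) 1" for x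
  have C': "(C has_vector_derivative C' x) (at x)" if "x \<in> I" for x
    unfolding C'_def using assms(2) that by (rule smooth_on_has_vector_derivative)
  have ode: "\<xi> x *\<^sub>R C' x + (C x ** A - A ** C x) + (4 * (k1 * x + k2)) *\<^sub>R C x = 0" if "x \<in> J" for x
    using adm that \<open>J \<subseteq> I\<close> by (auto simp: admits_gen_iff[OF C'])
  \<comment> \<open>The new coefficient matrix in terms of the old variable; \<open>D\<close> below
    is the same matrix as a function of s.\<close>
  define f where "f x = (\<xi> x * \<xi> x) *\<^sub>R C x + (k2 * k2 - k1 * k3) *\<^sub>R mat 1" for x
  define D where "D = f \<circ> the_inv_into J \<phi>"
  have D: "D (\<phi> x) = f x" if "x \<in> J" for x
    using that by (simp add: D_def the_inv_into_f_f[OF inj_\<phi>])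
  have "(D has_vector_derivative (A ** D s - D s ** A)) (at s)" if s: "s \<in> \<phi> ` J" for s
  proof -
    obtain x where x: "x \<in> J" "s = \<phi> x" using s by blast
    have "((\<lambda>x. \<xi> x * \<xi> x) has_real_derivative (4 * (k1 * x + k2) * \<xi> x)) (at x)"
      by (auto intro!: derivative_eq_intros simp: algebra_simps)
    moreover have "(C has_vector_derivative C' x) (at x)" using C' x(1) \<open>J \<subseteq> I\<close> by auto
    ultimately have "(f has_vector_derivative
        ((\<xi> x * \<xi> x) *\<^sub>R C' x + (4 * (k1 * x + k2) * \<xi> x) *\<^sub>R C x)) (at x)"
      unfolding f_def by (intro has_vector_derivative_add_const[THEN iffD2] has_vector_derivative_scaleR)
    from has_vector_derivative_new_variable[OF open_J subset_refl x(1) this D]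
    have "(D has_vector_derivative (\<sigma> / (w x * w x)) *\<^sub>R
        ((\<xi> x * \<xi> x) *\<^sub>R C' x + (4 * (k1 * x + k2) * \<xi> x) *\<^sub>R C x)) (at s)"
      using x(2) by simp
    moreover have "\<sigma> / (w x * w x) = \<xi> x"
    proof -
      have "\<sigma> = (\<sigma> * \<sigma>) * \<xi> x * (w x * w x)"
        using w[OF x(1)] by (metis mult.assoc mult.right_neutral)
      then show ?thesis using w_nonzero[OF x(1)] by (simp add: \<sigma> field_simps)
    qed
    \<comment> \<open>This is the determining equation times \<open>\<xi>\<close>^2; the multiple of
      \<open>mat 1\<close> in \<open>f\<close> drops out of the commutator.\<close>
    moreover have "\<xi> x *\<^sub>R ((\<xi> x * \<xi> x) *\<^sub>R C' x + (4 * (k1 * x + k2) * \<xi> x) *\<^sub>R C x) =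
        A ** f x - f x ** A"
    proof -
      have "\<xi> x *\<^sub>R C' x + (4 * (k1 * x + k2)) *\<^sub>R C x = A ** C x - C x ** A"
        using ode[OF x(1)] by (simp add: algebra_simps eq_neg_iff_add_eq_0)
      moreover have "A ** (c *\<^sub>R M + d *\<^sub>R mat 1) - (c *\<^sub>R M + d *\<^sub>R mat 1) ** A = c *\<^sub>R (A ** M - M ** A)"
        for c d M by (simp add: matmul_simps scaleR_diff_right)
      moreover have "c *\<^sub>R ((c * c) *\<^sub>R M + (d * c) *\<^sub>R N) = (c * c) *\<^sub>R (c *\<^sub>R M + d *\<^sub>R N)"
        for c d and M N :: "real^'m^'m" by (simp add: scaleR_add_right mult_ac)
      ultimately show ?thesis unfolding f_def by simp
    qed
    ultimately show ?thesis using D[OF x(1)] x(2) by simp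
  qed
  from exp_conj_ode_unique[OF open_interval_image this]
  obtain C0 where "\<And>s. s \<in> \<phi> ` J \<Longrightarrow> D s = exp_conj A C0 s" by blast
  then have C0: "exp_conj A C0 (\<phi> x) = (\<xi> x * \<xi> x) *\<^sub>R C x + (k2 * k2 - k1 * k3) *\<^sub>R mat 1"
    if "x \<in> J" for x
    using D[OF that] that by (simp add: f_def)
  have "C0 ** A - A ** C0 \<noteq> 0"
  proof
    assume "C0 ** A - A ** C0 = 0"
    then have "C0 = (\<xi> x * \<xi> x) *\<^sub>R C x + (k2 * k2 - k1 * k3) *\<^sub>R mat 1" if "x \<in> J" for x
      using C0[OF that] exp_conj_commuting[of C0 A] by simp
    from not_irreducible_if_constant[OF \<open>J \<subseteq> I\<close> this] irr show False by blast
  qed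
  moreover have "admits_lie_algebra (\<phi> ` J, linear_rhs (exp_conj A C0)) {gen 0 0 1 A}"
    using open_interval_image by (rule admits_lie_algebra_one) (simp_all add: admits_exp_conj_iff)
  ultimately show ?thesis
    by (intro exI[of _ "\<phi> ` J"] exI[of _ A] exI[of _ C0] conjI open_interval_image
        equivalent_to_new_variables[OF \<open>J \<subseteq> I\<close> C0])
qed

text \<open>The degenerate case \<open>\<xi>\<close> = 1, in which nothing is changed; it makes the
  general results available when X3 is already present.\<close>

lemma straightening_id: "open_interval I \<Longrightarrow> straightening I 0 0 1 1 (\<lambda>x. x) (\<lambda>_. 1)"
  by unfold_locales auto

text \<open>With X3 in the algebra the exponential form holds on all of \<open>I\<close> in the
  original variables. Both coefficient matrices and their derivatives agree on \<open>I\<close>, so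
  every other generator is inherited.\<close>

lemma normal_form_translation:
  fixes C :: "real \<Rightarrow> real^'m^'m"
  assumes I: "open_interval I" and "smooth_on I C" and irr: "irreducible_system (I, linear_rhs C)"
    and adm: "admits (I, linear_rhs C) (gen 0 0 1 A)"
  obtains C0 where "\<And>x. x \<in> I \<Longrightarrow> C x = exp_conj A C0 x"
    and "equivalent_to (I, linear_rhs C) (I, linear_rhs (exp_conj A C0))"
    and "A ** C0 - C0 ** A \<noteq> 0"
    and "\<And>l1 l2 l3 B. admits (I, linear_rhs C) (gen l1 l2 l3 B) \<longleftrightarrow>
       admits (I, linear_rhs (exp_conj A C0)) (gen l1 l2 l3 B)"
proof -
  interpret straightening I 0 0 1 1 "\<lambda>x. x" "\<lambda>_. 1" using I by (rule straightening_id)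
  define C' where "C' x = frechet_derivative C (at x) 1" for x
  have C': "(C has_vector_derivative C' x) (at x)" if "x \<in> I" for x
    unfolding C'_def using assms(2) that by (rule smooth_on_has_vector_derivative)
  have ode: "C' x = A ** C x - C x ** A" if "x \<in> I" for x
    using adm that by (auto simp: admits_gen_iff[OF C'] algebra_simps eq_neg_iff_add_eq_0)
  obtain C0 where C0: "\<And>x. x \<in> I \<Longrightarrow> C x = exp_conj A C0 x"
    using exp_conj_ode_unique[OF I, of C A] C' ode by metis
  have "A ** C0 - C0 ** A \<noteq> 0"
  proof
    assume "A ** C0 - C0 ** A = 0"
    \<comment> \<open>Spelled out to match the constancy criterion at \<open>k1 = 0\<close>,
      \<open>k2 = 0\<close>, \<open>k3 = 1\<close>.\<close>
    then have "C0 = ((0 * (x * x) + 2 * 0 * x + 1) * (0 * (x * x) + 2 * 0 * x + 1)) *\<^sub>R C x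
        + (0 * 0 - 0 * 1) *\<^sub>R mat 1" if "x \<in> I" for x
      using C0[OF that] exp_conj_commuting[of C0 A] by simp
    from not_irreducible_if_constant[OF subset_refl this] irr show False by blast
  qed
  moreover have "equivalent_to (I, linear_rhs C) (I, linear_rhs (exp_conj A C0))"
    using equivalent_to_new_variables[OF subset_refl, of "exp_conj A C0" C] C0 by simp
  moreover have "admits (I, linear_rhs C) (gen l1 l2 l3 B) \<longleftrightarrow>
       admits (I, linear_rhs (exp_conj A C0)) (gen l1 l2 l3 B)" for l1 l2 l3 B
    unfolding admits_exp_conj_iff using ode C0 by (simp add: admits_gen_iff[OF C'])
  ultimately show ?thesis using C0 that by blast
qed

section \<open>Scalar shifts and algebraic conditions on the constant matrix\<close>

lemma admits_gen_add_scalar: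
  fixes C :: "real \<Rightarrow> real^'m^'m"
  assumes "smooth_on I C" and "admits (I, linear_rhs C) (gen k1 k2 k3 A)"
  shows "admits (I, linear_rhs C) (gen k1 k2 k3 (A - c *\<^sub>R mat 1))"
  using assms(2)
  by (simp add: admits_gen_iff[OF smooth_on_has_vector_derivative[OF assms(1)]] matmul_simps algebra_simps)

text \<open>At one point \<open>x\<close>, \<open>B2\<close> is the conjugate of
  \<open>B2 + (2 * x) *\<^sub>R B3\<close>, so the whole determining equation is a conjugate.
  Undoing the conjugation leaves an equation for \<open>C0\<close> in which the terms in
  \<open>x\<close> cancel.\<close>

lemma scaling_relation:
  fixes B2 B3 C0 :: "real^'m^'m"
  assumes "I \<noteq> {}" and B23: "B2 ** B3 - B3 ** B2 = 2 *\<^sub>R B3"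
    and "admits (I, linear_rhs (exp_conj B3 C0)) (gen 0 1 0 B2)"
  shows "B2 ** C0 - C0 ** (B2 + 4 *\<^sub>R mat 1) = 0"
proof -
  obtain x where "x \<in> I" using assms(1) by blast
  let ?e = "\<lambda>M. exp_conj B3 M x"
  have "(2 * x) *\<^sub>R (?e B3 ** ?e C0 - ?e C0 ** ?e B3)
      + (?e C0 ** ?e (B2 + (2 * x) *\<^sub>R B3) - ?e (B2 + (2 * x) *\<^sub>R B3) ** ?e C0) + 4 *\<^sub>R ?e C0 = 0"
    using assms(3) \<open>x \<in> I\<close>
    by (simp add: admits_exp_conj_iff exp_conj_affine_commutator[OF B23] exp_conj_self)
  then have "?e ((2 * x) *\<^sub>R (B3 ** C0 - C0 ** B3)
      + (C0 ** (B2 + (2 * x) *\<^sub>R B3) - (B2 + (2 * x) *\<^sub>R B3) ** C0) + 4 *\<^sub>R C0) = ?e 0"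
    by (simp only: exp_conj_mult exp_conj_add exp_conj_diff exp_conj_scaleR) (simp add: exp_conj_def matmul_simps)
  then have "(2 * x) *\<^sub>R (B3 ** C0 - C0 ** B3)
      + (C0 ** (B2 + (2 * x) *\<^sub>R B3) - (B2 + (2 * x) *\<^sub>R B3) ** C0) + 4 *\<^sub>R C0 = 0"
    by (rule exp_conj_cancel)
  then have "C0 ** B2 - B2 ** C0 + 4 *\<^sub>R C0 = 0"
    by (simp add: matmul_simps algebra_simps)
  then show ?thesis by (simp add: matmul_simps algebra_simps)
qed

text \<open>As for scaling, now with the quadratic matrix: the terms in x^2 cancel, and those in x
  are a multiple of the scaling relation \<open>B2\<close>.\<close>

lemma projective_relation:
  fixes B1 B2 B3 C0 :: "real^'m^'m"
  assumes "I \<noteq> {}" and B23: "B2 ** B3 - B3 ** B2 = 2 *\<^sub>R B3" and B13: "B1 ** B3 - B3 ** B1 = B2"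
    and "admits (I, linear_rhs (exp_conj B3 C0)) (gen 1 0 0 B1)"
    and B2: "B2 ** C0 - C0 ** (B2 + 4 *\<^sub>R mat 1) = 0"
  shows "C0 ** B1 - B1 ** C0 = 0"
proof -
  obtain x where "x \<in> I" using assms(1) by blast
  let ?e = "\<lambda>M. exp_conj B3 M x" and ?B = "B1 + x *\<^sub>R B2 + (x * x) *\<^sub>R B3"
  have "(x * x) *\<^sub>R (?e B3 ** ?e C0 - ?e C0 ** ?e B3) + (?e C0 ** ?e ?B - ?e ?B ** ?e C0)
      + (4 * x) *\<^sub>R ?e C0 = 0"
    using assms(4) \<open>x \<in> I\<close>
    by (simp add: admits_exp_conj_iff exp_conj_quadratic_commutator[OF B23 B13] exp_conj_self)
  then have "?e ((x * x) *\<^sub>R (B3 ** C0 - C0 ** B3) + (C0 ** ?B - ?B ** C0) + (4 * x) *\<^sub>R C0) = ?e 0"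
    by (simp only: exp_conj_mult exp_conj_add exp_conj_diff exp_conj_scaleR) (simp add: exp_conj_def matmul_simps)
  then have "(x * x) *\<^sub>R (B3 ** C0 - C0 ** B3) + (C0 ** ?B - ?B ** C0) + (4 * x) *\<^sub>R C0 = 0"
    by (rule exp_conj_cancel)
  moreover have "(x * x) *\<^sub>R (B3 ** C0 - C0 ** B3) + (C0 ** ?B - ?B ** C0) + (4 * x) *\<^sub>R C0
      = (C0 ** B1 - B1 ** C0) - x *\<^sub>R (B2 ** C0 - C0 ** (B2 + 4 *\<^sub>R mat 1))"
    by (simp add: matmul_simps algebra_simps)
  ultimately show ?thesis using B2 by simp
qed

text \<open>A commutator has trace zero, so taking traces leaves only
  \<open>- 4 * trace C0\<close>.\<close>

lemma trace_eq_zero: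
  fixes B C0 :: "real^'m^'m"
  assumes "B ** C0 - C0 ** (B + 4 *\<^sub>R mat 1) = 0"
  shows "trace C0 = 0"
proof -
  have "trace (B ** C0 - C0 ** (B + 4 *\<^sub>R mat 1)) = trace (B ** C0) - trace (C0 ** B) - 4 * trace C0"
    by (simp add: matmul_simps trace_def sum_subtractf sum.distrib sum_distrib_left)
  then show ?thesis using assms trace_mul_sym[of B C0] by (simp add: trace_0[unfolded mat_0])
qed

lemma bracket_modulo_scalars:
  fixes A B :: "real^'m^'m"
  assumes "open_interval I" and "admits_lie_algebra (I, F) S" and "gen k1 k2 k3 A \<in> S" "gen l1 l2 l3 B \<in> S"
  shows "\<exists>c. trivial_generator (I, F) (\<lambda>w.
    gen (2 * (l1 * k2 - k1 * l2)) (l1 * k3 - k1 * l3) (2 * (l2 * k3 - k2 * l3)) (B ** A - A ** B) w - lincomb S c w)"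
  using assms(2,3,4) unfolding admits_lie_algebra_def lie_bracket_gen[symmetric] by blast

lemma normal_form_two:
  fixes C :: "real \<Rightarrow> real^'m^'m"
  assumes I: "open_interval I" and sm: "smooth_on I C" and irr: "irreducible_system (I, linear_rhs C)"
    and adm: "admits_lie_algebra (I, linear_rhs C) {gen 0 1 0 A2, gen 0 0 1 A3}"
  shows "\<exists>J C0 B2 B3. open_interval J \<and>
    equivalent_to (I, linear_rhs C) (J, linear_rhs (exp_conj B3 C0)) \<and>
    admits_lie_algebra (J, linear_rhs (exp_conj B3 C0)) {gen 0 1 0 B2, gen 0 0 1 B3} \<and>
    B2 ** B3 - B3 ** (B2 + 2 *\<^sub>R mat 1) = 0 \<and> B2 ** C0 - C0 ** (B2 + 4 *\<^sub>R mat 1) = 0 \<and>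
    trace C0 = 0 \<and> B3 ** C0 - C0 ** B3 \<noteq> 0"
proof -
  obtain c23 where "trivial_generator (I, linear_rhs C) (\<lambda>w. gen (2 * (0 * 1 - 0 * 0)) (0 * 0 - 0 * 1)
      (2 * (0 * 0 - 1 * 1)) (A3 ** A2 - A2 ** A3) w - lincomb {gen 0 1 0 A2, gen 0 0 1 A3} c23 w)"
    using bracket_modulo_scalars[OF I adm, of 0 1 0 A2 0 0 1 A3] by auto
  note t = trivial_generator_genD[OF I this[unfolded lincomb_two Let_def gen_diff]]
  \<comment> \<open>Comparing first components fixes the coefficients of the bracket as 0 for X2 and
    -2 for X3; what remains of the matrix part is scalar.\<close>
  then obtain d where d: "A3 ** A2 - A2 ** A3 + 2 *\<^sub>R A3 = d *\<^sub>R mat 1" by auto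
  \<comment> \<open>Half of \<open>d\<close>, since the shifted matrix occurs with factor 2 in the
    relation, while commutators ignore the shift.\<close>
  define B3 where "B3 = A3 - (d / 2) *\<^sub>R mat 1"
  have B23: "A2 ** B3 - B3 ** A2 = 2 *\<^sub>R B3"
    using d by (simp add: B3_def matmul_simps algebra_simps)
  have admV: "admits (I, linear_rhs C) (gen 0 1 0 A2)" "admits (I, linear_rhs C) (gen 0 0 1 B3)"
    unfolding B3_def using adm sm by (auto simp: admits_lie_algebra_def intro: admits_gen_add_scalar)
  obtain C0 where C0: "equivalent_to (I, linear_rhs C) (I, linear_rhs (exp_conj B3 C0))"
    "B3 ** C0 - C0 ** B3 \<noteq> 0"
    "\<And>l1 l2 l3 B. admits (I, linear_rhs C) (gen l1 l2 l3 B) \<longleftrightarrow>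
       admits (I, linear_rhs (exp_conj B3 C0)) (gen l1 l2 l3 B)"
    using normal_form_translation[OF I sm irr admV(2)] by metis
  have "I \<noteq> {}" using I by (simp add: open_interval_def)
  then have rel: "A2 ** C0 - C0 ** (A2 + 4 *\<^sub>R mat 1) = 0"
    using B23 admV(1)[unfolded C0(3)] by (rule scaling_relation)
  have "A2 ** B3 - B3 ** (A2 + 2 *\<^sub>R mat 1) = 0"
    using B23 by (simp add: matmul_simps algebra_simps)
  then show ?thesis
    using I C0(1,2) rel trace_eq_zero[OF rel] admits_lie_algebra_two[OF I admV[unfolded C0(3)] B23]
    by (intro exI[of _ I] exI[of _ C0] exI[of _ A2] exI[of _ B3] conjI)
qed

lemma normal_form_three:
  fixes C :: "real \<Rightarrow> real^'m^'m"
  assumes I: "open_interval I" and sm: "smooth_on I C" and irr: "irreducible_system (I, linear_rhs C)"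
    and adm: "admits_lie_algebra (I, linear_rhs C) {gen 1 0 0 A1, gen 0 1 0 A2, gen 0 0 1 A3}"
  shows "\<exists>J C0 B1 B2 B3. open_interval J \<and>
    equivalent_to (I, linear_rhs C) (J, linear_rhs (exp_conj B3 C0)) \<and>
    admits_lie_algebra (J, linear_rhs (exp_conj B3 C0)) {gen 1 0 0 B1, gen 0 1 0 B2, gen 0 0 1 B3} \<and>
    B1 ** B2 - B2 ** B1 = 2 *\<^sub>R B1 \<and> B1 ** B3 - B3 ** B1 = B2 \<and> B2 ** B3 - B3 ** B2 = 2 *\<^sub>R B3 \<and>
    B2 ** C0 - C0 ** (B2 + 4 *\<^sub>R mat 1) = 0 \<and> C0 ** B1 - B1 ** C0 = 0 \<and>
    trace C0 = 0 \<and> B3 ** C0 - C0 ** B3 \<noteq> 0"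
proof -
  let ?S = "{gen 1 0 0 A1, gen 0 1 0 A2, gen 0 0 1 A3}"
  obtain c12 where "trivial_generator (I, linear_rhs C) (\<lambda>w. gen (2 * (0 * 0 - 1 * 1)) (0 * 0 - 1 * 0)
      (2 * (1 * 0 - 0 * 0)) (A2 ** A1 - A1 ** A2) w - lincomb ?S c12 w)"
    using bracket_modulo_scalars[OF I adm, of 1 0 0 A1 0 1 0 A2] by auto
  note t = trivial_generator_genD[OF I this[unfolded lincomb_three Let_def gen_diff]]
  then obtain d1 where d1: "A2 ** A1 - A1 ** A2 + 2 *\<^sub>R A1 = d1 *\<^sub>R mat 1" by auto
  obtain c13 where "trivial_generator (I, linear_rhs C) (\<lambda>w. gen (2 * (0 * 0 - 1 * 0)) (0 * 0 - 1 * 1)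
      (2 * (0 * 0 - 0 * 1)) (A3 ** A1 - A1 ** A3) w - lincomb ?S c13 w)"
    using bracket_modulo_scalars[OF I adm, of 1 0 0 A1 0 0 1 A3] by auto
  note t = trivial_generator_genD[OF I this[unfolded lincomb_three Let_def gen_diff]]
  \<comment> \<open>The bracket of the first and third generators is minus the second, modulo
    trivial ones.\<close>
  then have "c13 (gen 0 1 0 A2) = - 1" by simp
  with t obtain d2 where d2: "A3 ** A1 - A1 ** A3 + A2 = d2 *\<^sub>R mat 1" by auto
  obtain c23 where "trivial_generator (I, linear_rhs C) (\<lambda>w. gen (2 * (0 * 1 - 0 * 0)) (0 * 0 - 0 * 1)
      (2 * (0 * 0 - 1 * 1)) (A3 ** A2 - A2 ** A3) w - lincomb ?S c23 w)"
    using bracket_modulo_scalars[OF I adm, of 0 1 0 A2 0 0 1 A3] by auto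
  note t = trivial_generator_genD[OF I this[unfolded lincomb_three Let_def gen_diff]]
  then obtain d3 where d3: "A3 ** A2 - A2 ** A3 + 2 *\<^sub>R A3 = d3 *\<^sub>R mat 1" by auto
  \<comment> \<open>The shifts of \<open>A1\<close> and \<open>A3\<close> are halved because
    \<open>B1\<close> and \<open>B3\<close> occur doubled in their relations, whereas
    \<open>B2\<close> occurs once.\<close>
  define B1 where "B1 = A1 - (d1 / 2) *\<^sub>R mat 1"
  define B2 where "B2 = A2 - d2 *\<^sub>R mat 1"
  define B3 where "B3 = A3 - (d3 / 2) *\<^sub>R mat 1"
  have B12: "B1 ** B2 - B2 ** B1 = 2 *\<^sub>R B1"
    using d1 by (simp add: B1_def B2_def matmul_simps algebra_simps)
  have B13: "B1 ** B3 - B3 ** B1 = B2"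
    using d2 by (simp add: B1_def B2_def B3_def matmul_simps algebra_simps)
  have B23: "B2 ** B3 - B3 ** B2 = 2 *\<^sub>R B3"
    using d3 by (simp add: B2_def B3_def matmul_simps algebra_simps)
  have admV: "admits (I, linear_rhs C) (gen 1 0 0 B1)" "admits (I, linear_rhs C) (gen 0 1 0 B2)"
    "admits (I, linear_rhs C) (gen 0 0 1 B3)"
    unfolding B1_def B2_def B3_def using adm sm
    by (auto simp: admits_lie_algebra_def intro: admits_gen_add_scalar)
  obtain C0 where C0: "equivalent_to (I, linear_rhs C) (I, linear_rhs (exp_conj B3 C0))"
    "B3 ** C0 - C0 ** B3 \<noteq> 0"
    "\<And>l1 l2 l3 B. admits (I, linear_rhs C) (gen l1 l2 l3 B) \<longleftrightarrow>
       admits (I, linear_rhs (exp_conj B3 C0)) (gen l1 l2 l3 B)"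
    using normal_form_translation[OF I sm irr admV(3)] by metis
  have "I \<noteq> {}" using I by (simp add: open_interval_def)
  then have rel: "B2 ** C0 - C0 ** (B2 + 4 *\<^sub>R mat 1) = 0"
    using B23 admV(2)[unfolded C0(3)] by (rule scaling_relation)
  have "C0 ** B1 - B1 ** C0 = 0"
    using \<open>I \<noteq> {}\<close> B23 B13 admV(1)[unfolded C0(3)] rel by (rule projective_relation)
  then show ?thesis
    using I C0(1,2) rel trace_eq_zero[OF rel] B12 B13 B23
      admits_lie_algebra_three[OF I admV[unfolded C0(3)] B12 B13 B23]
    by (intro exI[of _ I] exI[of _ C0] exI[of _ B1] exI[of _ B2] exI[of _ B3] conjI)
qed

theorem mainTheorem1:
  fixes I :: "real set" and C :: "real \<Rightarrow> real^'m^'m" and A1 A2 A3 :: "real^'m^'m"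
  assumes "open_interval I"
    and "smooth_on I C"
    and "irreducible_system (I, linear_rhs C)"
  shows
    "(admits_lie_algebra (I, linear_rhs C) {X2 \<oplus>\<^sub>v XA A2} \<or>
      admits_lie_algebra (I, linear_rhs C) {X3 \<oplus>\<^sub>v XA A3} \<or>
      admits_lie_algebra (I, linear_rhs C) {X1 \<oplus>\<^sub>v X3 \<oplus>\<^sub>v XA A1}
      \<longrightarrow> (\<exists>J A C0.
            open_interval J \<and> equivalent_to (I, linear_rhs C) (J, linear_rhs (exp_conj A C0)) \<and>
            C0 ** A - A ** C0 \<noteq> 0 \<and>
            admits_lie_algebra (J, linear_rhs (exp_conj A C0)) {X3 \<oplus>\<^sub>v XA A}))
     \<and>
     (admits_lie_algebra (I, linear_rhs C) {X2 \<oplus>\<^sub>v XA A2, X3 \<oplus>\<^sub>v XA A3}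
      \<longrightarrow> (\<exists>J C0 B2 B3.
            open_interval J \<and> equivalent_to (I, linear_rhs C) (J, linear_rhs (exp_conj B3 C0)) \<and>
            admits_lie_algebra (J, linear_rhs (exp_conj B3 C0))
              {X2 \<oplus>\<^sub>v XA B2, X3 \<oplus>\<^sub>v XA B3} \<and>
            B2 ** B3 - B3 ** (B2 + 2 *\<^sub>R mat 1) = 0 \<and>
            B2 ** C0 - C0 ** (B2 + 4 *\<^sub>R mat 1) = 0 \<and>
            trace C0 = 0 \<and>
            B3 ** C0 - C0 ** B3 \<noteq> 0))
     \<and>
     (admits_lie_algebra (I, linear_rhs C) {X1 \<oplus>\<^sub>v XA A1, X2 \<oplus>\<^sub>v XA A2, X3 \<oplus>\<^sub>v XA A3}
      \<longrightarrow> (\<exists>J C0 B1 B2 B3.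
            open_interval J \<and> equivalent_to (I, linear_rhs C) (J, linear_rhs (exp_conj B3 C0)) \<and>
            admits_lie_algebra (J, linear_rhs (exp_conj B3 C0))
              {X1 \<oplus>\<^sub>v XA B1, X2 \<oplus>\<^sub>v XA B2, X3 \<oplus>\<^sub>v XA B3} \<and>
            B1 ** B2 - B2 ** B1 = 2 *\<^sub>R B1 \<and>
            B1 ** B3 - B3 ** B1 = B2 \<and>
            B2 ** B3 - B3 ** B2 = 2 *\<^sub>R B3 \<and>
            B2 ** C0 - C0 ** (B2 + 4 *\<^sub>R mat 1) = 0 \<and>
            C0 ** B1 - B1 ** C0 = 0 \<and>
            trace C0 = 0 \<and>
            B3 ** C0 - C0 ** B3 \<noteq> 0))"
  unfolding generator_eq_gen
proof (intro conjI impI)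
  assume "admits_lie_algebra (I, linear_rhs C) {gen 0 1 0 A2} \<or>
    admits_lie_algebra (I, linear_rhs C) {gen 0 0 1 A3} \<or>
    admits_lie_algebra (I, linear_rhs C) {gen 1 0 1 A1}"
  then have "admits (I, linear_rhs C) (gen 0 1 0 A2) \<or> admits (I, linear_rhs C) (gen 0 0 1 A3) \<or>
      admits (I, linear_rhs C) (gen 1 0 1 A1)"
    by (elim disjE) (simp_all add: admits_lie_algebra_def)
  \<comment> \<open>The three one-dimensional algebras differ only in the triple: (0, 1, 0), (0, 0,
    1) or (1, 0, 1).\<close>
  then obtain k1 k2 k3 A where adm: "admits (I, linear_rhs C) (gen k1 k2 k3 A)" and k: "(k1, k2, k3) \<noteq> (0, 0, 0)"
    by (elim disjE) (erule that, simp)+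
  show "\<exists>J A C0. open_interval J \<and>
      equivalent_to (I, linear_rhs C) (J, linear_rhs (exp_conj A C0)) \<and>
      C0 ** A - A ** C0 \<noteq> 0 \<and>
      admits_lie_algebra (J, linear_rhs (exp_conj A C0)) {gen 0 0 1 A}"
    using assms adm k by (rule normal_form_one)
qed (rule normal_form_two[OF assms] normal_form_three[OF assms], assumption)+

end
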